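(* Let $A$ be a separable C*-algebra, let $B\subseteq A$ be a closed *-subalgebra containing an approximate unit for $A$, and let $\varphi:J\to A$ be a virtual commutant of $B$ in $A$, where $J$ is a closed two-sided ideal of $B$. Suppose that $A$ is faithfully represented on a Hilbert space $H$, and identify $A$ with its image in $B(H)$. Then there exists $\tau\in B(H)$ such that for every $x\in J$: (i) $\tau x\in A$; (ii) $\varphi(x)=\tau x$; and (iii) $\tau$ commutes with every element of $B$.
   Context: A virtual commutant of $B$ in $A$ is a linear map $\varphi:J\to A$ defined on a closed two-sided ideal $J$ of $B$ such that $\varphi(bx)=b\varphi(x)$ and $\varphi(xb)=\varphi(x)b$ for all $x\in J$ and $b\in B$. $B(H)$ denotes the bounded operators on $H$. *)

theory Defs
  imports "HOL-Analysis.Analysis"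
begin

class scaleC =
  fixes scaleC :: "complex \<Rightarrow> 'a \<Rightarrow> 'a"  (infixr \<open>*\<^sub>C\<close> 75)

class complex_normed_vector = real_normed_vector + scaleC +
  assumes scaleC_add_right: "c *\<^sub>C (x + y) = c *\<^sub>C x + c *\<^sub>C y"
    and scaleC_add_left: "(c + d) *\<^sub>C x = c *\<^sub>C x + d *\<^sub>C x"
    and scaleC_scaleC: "c *\<^sub>C d *\<^sub>C x = (c * d) *\<^sub>C x"
    and scaleC_one: "1 *\<^sub>C x = x"
    and scaleR_scaleC: "r *\<^sub>R x = complex_of_real r *\<^sub>C x"
    and norm_scaleC: "norm (c *\<^sub>C x) = cmod c * norm x"

text \<open>C*-algebras, not assumed unital and possibly zero.\<close>

class cstar_algebra = complex_normed_vector + real_normed_algebra + banach +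
  fixes star :: "'a \<Rightarrow> 'a"
  assumes mult_scaleC_left: "(c *\<^sub>C x) * y = c *\<^sub>C (x * y)"
    and mult_scaleC_right: "x * (c *\<^sub>C y) = c *\<^sub>C (x * y)"
    and star_add: "star (x + y) = star x + star y"
    and star_scaleC: "star (c *\<^sub>C x) = cnj c *\<^sub>C star x"
    and star_mult: "star (x * y) = star y * star x"
    and star_star: "star (star x) = x"
    and cstar_identity: "norm (star x * x) = (norm x)\<^sup>2"

text \<open>Complex Hilbert spaces. The inner product is linear in its first argument.
  Since the norm comes from \<^class>\<open>real_normed_vector\<close>, the last axiom also gives
  positive definiteness.\<close>

class complex_hilbert = complex_normed_vector + banach +
  fixes cinner :: "'a \<Rightarrow> 'a \<Rightarrow> complex"
  assumes cinner_add_left: "cinner (x + y) z = cinner x z + cinner y z"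
    and cinner_scaleC_left: "cinner (c *\<^sub>C x) y = c * cinner x y"
    and cinner_commute: "cinner x y = cnj (cinner y x)"
    and cinner_self: "cinner x x = complex_of_real ((norm x)\<^sup>2)"

text \<open>\<open>B(H)\<close>: the type \<open>'h \<Rightarrow>\<^sub>L 'h\<close> consists of the bounded real-linear maps,
  so complex homogeneity is imposed separately.\<close>

definition bounded_operators :: "('h::complex_hilbert \<Rightarrow>\<^sub>L 'h) set" where
  "bounded_operators = {T. \<forall>c v. blinfun_apply T (c *\<^sub>C v) = c *\<^sub>C blinfun_apply T v}"

text \<open>The fourth clause below says that \<open>\<pi> (c *\<^sub>C a) = c \<cdot> \<pi> a\<close>, and the last one that
  \<open>\<pi> (star a)\<close> is the Hilbert space adjoint of \<open>\<pi> a\<close>. Nondegeneracy is not required.\<close>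

definition star_representation :: "('a::cstar_algebra \<Rightarrow> 'h::complex_hilbert \<Rightarrow>\<^sub>L 'h) \<Rightarrow> bool" where
  "star_representation \<pi> \<longleftrightarrow>
     range \<pi> \<subseteq> bounded_operators \<and>
     (\<forall>a b. \<pi> (a + b) = \<pi> a + \<pi> b) \<and>
     (\<forall>a b. \<pi> (a * b) = \<pi> a o\<^sub>L \<pi> b) \<and>
     (\<forall>c a v. blinfun_apply (\<pi> (c *\<^sub>C a)) v = c *\<^sub>C blinfun_apply (\<pi> a) v) \<and>
     (\<forall>a v w. cinner (blinfun_apply (\<pi> (star a)) v) w = cinner v (blinfun_apply (\<pi> a) w))"

definition faithful_representation :: "('a::cstar_algebra \<Rightarrow> 'h::complex_hilbert \<Rightarrow>\<^sub>L 'h) \<Rightarrow> bool" where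
  "faithful_representation \<pi> \<longleftrightarrow> star_representation \<pi> \<and> inj \<pi>"

definition complex_subspace :: "'a::complex_normed_vector set \<Rightarrow> bool" where
  "complex_subspace S \<longleftrightarrow>
     0 \<in> S \<and> (\<forall>x\<in>S. \<forall>y\<in>S. x + y \<in> S) \<and> (\<forall>c. \<forall>x\<in>S. c *\<^sub>C x \<in> S)"

definition closed_star_subalgebra :: "'a::cstar_algebra set \<Rightarrow> bool" where
  "closed_star_subalgebra B \<longleftrightarrow>
     complex_subspace B \<and> (\<forall>x\<in>B. \<forall>y\<in>B. x * y \<in> B) \<and> (\<forall>x\<in>B. star x \<in> B) \<and> closed B"

text \<open>A net in \<open>B\<close> is represented by the filter that it generates on the algebra (the
  image of the tails of its index set). Neither boundedness nor monotonicity of the net is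
  asked for, so that nets that are approximate units under any of the usual conventions
  (contractive, positive, increasing) qualify.\<close>

definition contains_approximate_unit :: "'a::cstar_algebra set \<Rightarrow> bool" where
  "contains_approximate_unit B \<longleftrightarrow>
     (\<exists>F. F \<noteq> bot \<and> (\<forall>\<^sub>F e in F. e \<in> B) \<and>
          (\<forall>a. ((\<lambda>e. e * a) \<longlongrightarrow> a) F \<and> ((\<lambda>e. a * e) \<longlongrightarrow> a) F))"

definition closed_two_sided_ideal :: "'a::cstar_algebra set \<Rightarrow> 'a set \<Rightarrow> bool" where
  "closed_two_sided_ideal J B \<longleftrightarrow>
     J \<subseteq> B \<and> complex_subspace J \<and> (\<forall>x\<in>J. \<forall>b\<in>B. b * x \<in> J \<and> x * b \<in> J) \<and> closed J"

text \<open>Only the values of \<open>\<phi>\<close> on \<open>J\<close> matter; \<open>\<phi>\<close> is not assumed to be bounded.\<close>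

definition virtual_commutant :: "'a::cstar_algebra set \<Rightarrow> 'a set \<Rightarrow> ('a \<Rightarrow> 'a) \<Rightarrow> bool" where
  "virtual_commutant B J \<phi> \<longleftrightarrow>
     closed_two_sided_ideal J B \<and>
     (\<forall>x\<in>J. \<forall>y\<in>J. \<phi> (x + y) = \<phi> x + \<phi> y) \<and>
     (\<forall>c. \<forall>x\<in>J. \<phi> (c *\<^sub>C x) = c *\<^sub>C \<phi> x) \<and>
     (\<forall>x\<in>J. \<forall>b\<in>B. \<phi> (b * x) = b * \<phi> x \<and> \<phi> (x * b) = \<phi> x * b)"

end

theory Submission
  imports Defs
begin

text \<open>The operator \<open>\<tau>\<close> is a strong limit of \<open>\<pi> (\<phi> (f n))\<close>, where \<open>f n \<in> J\<close> is bounded and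
  \<open>\<pi> (f n)\<close> converges strongly to the projection onto the closed span of \<open>\<pi> J H\<close>. On \<open>\<pi> J H\<close> one
  has \<open>\<phi> (f n) x = f n \<phi> x\<close>, so the limit is \<open>\<pi> (\<phi> x)\<close>; on the orthogonal complement it is 0.
  Both steps need \<open>\<phi> x \<in> J A\<close>, and boundedness of \<open>\<phi>\<close> is needed as well. They follow from the
  factorization \<open>a = q z\<close> of a self-adjoint \<open>a \<in> J\<close>, with \<open>q = (a\<^sup>2)\<^sup>1\<^sup>/\<^sup>4\<close> and \<open>\<parallel>q\<parallel> \<parallel>z\<parallel> = \<parallel>a\<parallel>\<close>.
  Spectral theory is avoided: \<open>\<parallel>1 - a\<^sup>2\<parallel> \<le> 1\<close> for self-adjoint \<open>a\<close> of norm below 1 because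
  \<open>\<surd>(1 - a\<^sup>2)\<close> is a mean of two unitaries, and power series in \<open>1 - p\<close> then supply the square
  roots. There need not be a unit, and \<open>1 - e\<close> stands for the map \<open>y \<mapsto> y - e y\<close>.\<close>

section \<open>Elementary facts on C*-algebras\<close>

lemma scaleC_zero_left [simp]: "(0::complex) *\<^sub>C (x::'a::complex_normed_vector) = 0"
  using scaleR_scaleC[of 0 x] by simp

lemma scaleC_minus_one: "(-1::complex) *\<^sub>C (x::'a::complex_normed_vector) = - x"
  using scaleR_scaleC[of "-1" x] by simp

lemma scaleC_minus_left: "(- c) *\<^sub>C (x::'a::complex_normed_vector) = - (c *\<^sub>C x)"
  by (metis scaleC_minus_one scaleC_scaleC mult_minus1)

lemma scaleC_minus_right: "c *\<^sub>C (- x::'a::complex_normed_vector) = - (c *\<^sub>C x)"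
  by (metis scaleC_minus_one scaleC_scaleC mult.commute)

lemma scaleC_diff_right: "c *\<^sub>C (x - y::'a::complex_normed_vector) = c *\<^sub>C x - c *\<^sub>C y"
  using scaleC_add_right[of c x "- y"] by (simp add: scaleC_minus_right)

lemma star_scaleR: "star (r *\<^sub>R x) = r *\<^sub>R star (x::'a::cstar_algebra)"
  by (simp add: scaleR_scaleC star_scaleC)

lemma star_zero [simp]: "star (0::'a::cstar_algebra) = 0"
  using star_scaleR[of 0 "0::'a"] by simp

lemma star_minus: "star (- x) = - star (x::'a::cstar_algebra)"
  using star_scaleR[of "-1" x] by simp

lemma star_diff: "star (x - y) = star x - star (y::'a::cstar_algebra)"
  using star_add[of x "- y"] by (simp add: star_minus)

lemma norm_star: "norm (star x) = norm (x::'a::cstar_algebra)"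
proof -
  have *: "norm y \<le> norm (star y)" for y :: 'a
  proof (cases "norm y = 0")
    case False
    have "norm y * norm y \<le> norm (star y) * norm y"
      using cstar_identity[of y] norm_mult_ineq[of "star y" y] by (simp add: power2_eq_square)
    with False show ?thesis by simp
  qed simp
  show ?thesis using *[of x] *[of "star x"] by (simp add: star_star)
qed

lemma cstar_identity': "norm (x * star x) = (norm (x::'a::cstar_algebra))\<^sup>2"
  using cstar_identity[of "star x"] by (simp add: star_star norm_star)

lemma norm_mult_self_adjoint:
  "star x = x \<Longrightarrow> norm (x * x) = (norm (x::'a::cstar_algebra))\<^sup>2"
  using cstar_identity[of x] by simp

lemma bounded_linear_star: "bounded_linear (star :: 'a::cstar_algebra \<Rightarrow> 'a)"
  by (rule bounded_linear_intro[where K = 1]) (simp_all add: star_add star_scaleR norm_star)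

lemma bounded_linear_scaleC: "bounded_linear ((*\<^sub>C) c :: 'a::complex_normed_vector \<Rightarrow> 'a)"
proof (rule bounded_linear_intro[where K = "cmod c"])
  fix x y :: 'a and r :: real
  show "c *\<^sub>C (x + y) = c *\<^sub>C x + c *\<^sub>C y" by (rule scaleC_add_right)
  show "c *\<^sub>C r *\<^sub>R x = r *\<^sub>R c *\<^sub>C x"
    unfolding scaleR_scaleC scaleC_scaleC by (simp only: mult.commute)
  show "norm (c *\<^sub>C x) \<le> norm x * cmod c" by (simp add: norm_scaleC)
qed

lemma closed_self_adjoint: "closed {x::'a::cstar_algebra. star x = x}"
  by (intro closed_Collect_eq bounded_linear.continuous_on[OF bounded_linear_star] continuous_on_id)

text \<open>Only real scalars are asked for, since all series and means below have real
  coefficients. Closure under \<open>star\<close> is left out so that a closed ideal qualifies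
  before it is known to be self-adjoint.\<close>

definition closed_subalgebra :: "'a::cstar_algebra set \<Rightarrow> bool" where
  "closed_subalgebra S \<longleftrightarrow> subspace S \<and> closed S \<and> (\<forall>x\<in>S. \<forall>y\<in>S. x * y \<in> S)"

lemma closed_subalgebraD:
  assumes "closed_subalgebra S"
  shows "subspace S" "closed S" "0 \<in> S" "x \<in> S \<Longrightarrow> y \<in> S \<Longrightarrow> x * y \<in> S"
    "x \<in> S \<Longrightarrow> y \<in> S \<Longrightarrow> x + y \<in> S" "x \<in> S \<Longrightarrow> y \<in> S \<Longrightarrow> x - y \<in> S"
    "x \<in> S \<Longrightarrow> r *\<^sub>R x \<in> S"
  using assms unfolding closed_subalgebra_def
  by (auto simp: subspace_0 subspace_add subspace_diff subspace_scale)

lemma closed_subalgebra_suminf: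
  assumes "closed_subalgebra S" "\<And>n::nat. f n \<in> S" "summable f"
  shows "suminf f \<in> S"
proof (rule closed_sequentially[OF closed_subalgebraD(2)[OF assms(1)]])
  show "(\<lambda>n. sum f {..<n}) \<longlonglongrightarrow> suminf f" using assms(3) by (rule summable_LIMSEQ)
  show "sum f {..<n} \<in> S" for n
    by (rule subspace_sum[OF closed_subalgebraD(1)[OF assms(1)] assms(2)])
qed

lemma closed_subalgebra_Int:
  "closed_subalgebra S \<Longrightarrow> closed_subalgebra T \<Longrightarrow> closed_subalgebra (S \<inter> T)"
  unfolding closed_subalgebra_def by (auto intro: subspace_inter)

text \<open>Intersecting with this subalgebra makes the elements built below by series and means
  commute with \<open>a\<close>.\<close>

lemma closed_subalgebra_centralizer: "closed_subalgebra {y. y * a = a * y}"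
proof -
  have "closed {y. y * a = a * y}"
    by (intro closed_Collect_eq continuous_intros)
  moreover have "subspace {y. y * a = a * y}"
    by (auto simp: subspace_def algebra_simps)
  moreover have "x * y * a = a * (x * y)" if "x * a = a * x" "y * a = a * y" for x y
    using that by (metis mult.assoc)
  ultimately show ?thesis by (simp add: closed_subalgebra_def)
qed

lemma self_adjoint_suminf:
  fixes f :: "nat \<Rightarrow> 'a::cstar_algebra"
  assumes "\<And>n. star (f n) = f n" "summable f"
  shows "star (suminf f) = suminf f"
  using bounded_linear.suminf[OF bounded_linear_star assms(2)] assms(1) by simp

section \<open>Square roots\<close>

text \<open>Formally \<open>(1 - d)\<^sup>2 = 1 - a\<^sup>2\<close>.\<close>

lemma sqrt_one_minus_square:
  fixes a :: "'a::cstar_algebra"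
  assumes sa: "star a = a" and less: "norm a < 1"
  obtains d where "star d = d" "d * a = a * d" "d + d - d * d = a * a"
proof -
  define s where "s = (norm a)\<^sup>2"
  have s: "0 \<le> s" "s < 1" and na: "norm (a * a) \<le> s"
    using less norm_mult_ineq[of a a] abs_square_less_1[of "norm a"]
    by (auto simp: s_def power2_eq_square)
  \<comment> \<open>The equation for \<open>d\<close> is the fixed point equation
    \<open>d = (a * a + d * d) / 2\<close>. The radius \<open>s\<close> bounds \<open>a * a\<close>,
    and as \<open>s < 1\<close> it also serves as contraction constant of \<open>f\<close> on the
    ball.\<close>
  let ?S = "{d. star d = d} \<inter> {d. d * a = a * d} \<inter> cball 0 s"
  define f where "f d = (1/2) *\<^sub>R (a * a + d * d)" for d
  have c: "complete ?S"
    using closed_subalgebraD(2)[OF closed_subalgebra_centralizer[of a]] closed_self_adjoint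
    by (auto simp: complete_eq_closed)
  have ne: "?S \<noteq> {}"
  proof -
    have "0 \<in> ?S" using s by simp
    then show ?thesis by blast
  qed
  have im: "f ` ?S \<subseteq> ?S"
  proof safe
    fix d assume d: "star d = d" "d * a = a * d" "d \<in> cball 0 s"
    show "star (f d) = f d"
      by (simp add: f_def star_scaleR star_add star_mult sa d)
    have "d * d * a = a * (d * d)" using d(2) by (metis mult.assoc)
    then show "f d * a = a * f d" by (simp add: f_def algebra_simps)
    have "norm (d * d) \<le> s * s"
      using d(3) norm_mult_ineq[of d d] mult_mono[of "norm d" s "norm d" s] s by auto
    also have "\<dots> \<le> s" using s by (simp add: mult_left_le)
    finally have "norm (a * a + d * d) \<le> s + s"
      using na norm_triangle_ineq[of "a*a" "d*d"] by linarith
    then show "f d \<in> cball 0 s" by (simp add: f_def)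
  qed
  have lip: "dist (f x) (f y) \<le> s * dist x y" if "x \<in> ?S" "y \<in> ?S" for x y
  proof -
    have "norm (x * x - y * y) = norm (x * (x - y) + (x - y) * y)"
      by (simp add: algebra_simps)
    also have "\<dots> \<le> norm (x * (x - y)) + norm ((x - y) * y)" by (rule norm_triangle_ineq)
    also have "\<dots> \<le> norm x * norm (x - y) + norm (x - y) * norm y"
      by (intro add_mono norm_mult_ineq)
    also have "\<dots> \<le> s * norm (x - y) + norm (x - y) * s"
      using that by (intro add_mono mult_right_mono mult_left_mono) auto
    finally have "norm (x * x - y * y) \<le> 2 * (s * norm (x - y))" by simp
    moreover have "f x - f y = (1/2) *\<^sub>R (x * x - y * y)"
      by (simp add: f_def algebra_simps)
    ultimately show ?thesis by (simp add: dist_norm)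
  qed
  obtain d where d: "d \<in> ?S" "f d = d"
    using Banach_fix[OF c ne s im] lip by blast
  have "d + d = 2 *\<^sub>R f d" unfolding d(2) by (simp add: scaleR_2)
  then have "d + d - d * d = a * a" by (simp add: f_def)
  with d that show ?thesis by blast
qed

text \<open>Formally, \<open>e\<close> is self-adjoint and \<open>1 - e\<close> is a contraction.\<close>

definition cocontraction :: "'a::cstar_algebra \<Rightarrow> bool" where
  "cocontraction e \<longleftrightarrow> star e = e \<and> (\<forall>y. norm (y - e * y) \<le> norm y)"

lemma cocontractionD:
  assumes "cocontraction e"
  shows "star e = e" "norm (y - e * y) \<le> norm y"
  using assms by (auto simp: cocontraction_def)

text \<open>Taking \<open>y = e\<close> in the definition gives
  \<open>norm (e * e) \<le> 2 * norm e\<close>, and the left side is the square of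
  \<open>norm e\<close>.\<close>

lemma cocontraction_norm_le:
  assumes "cocontraction e"
  shows "norm e \<le> 2"
proof (cases "norm e = 0")
  case False
  have "norm e * norm e = norm (e * e)"
    using norm_mult_self_adjoint[OF cocontractionD(1)[OF assms]] by (simp add: power2_eq_square)
  also have "\<dots> \<le> norm e + norm (e - e * e)"
    by (metis add_diff_cancel_left' diff_diff_eq2 norm_triangle_ineq4)
  also have "\<dots> \<le> 2 * norm e" using cocontractionD(2)[OF assms, of e] by simp
  finally show ?thesis using False by simp
qed simp

text \<open>With \<open>d\<close> as above, \<open>(1 - d) \<plusminus> \<i>a\<close> are unitary and \<open>1 - d\<close> is their mean.\<close>

lemma cocontraction_square:
  fixes a :: "'a::cstar_algebra"
  assumes sa: "star a = a" and less: "norm a < 1"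
  shows "cocontraction (a * a)"
proof -
  obtain d where d: "star d = d" "d * a = a * d" "d + d - d * d = a * a"
    using sqrt_one_minus_square[OF assms] .
  \<comment> \<open>The conditions on \<open>c\<close> describe the two imaginary units. In
    \<open>star ?u * ?u\<close> the cross terms cancel because \<open>d\<close> commutes with
    \<open>a\<close>; what remains is \<open>star y * y\<close> by the formal identity
    \<open>(1 - d)(1 - d) + a * a = 1\<close>.\<close>
  have U: "norm (y - d * y + c *\<^sub>C (a * y)) = norm y" if c: "cnj c = - c" "c * c = -1" for c y
  proof -
    let ?u = "y - d * y + c *\<^sub>C (a * y)"
    have "star ?u = star y - star y * d - c *\<^sub>C (star y * a)"
      by (simp add: star_add star_diff star_mult star_scaleC sa d c scaleC_minus_left)
    moreover have "(A - C) * (V + W) = A * V - C * W + A * W - C * V" for A C V W :: 'a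
      by (simp add: algebra_simps)
    ultimately have "star ?u * ?u = (star y - star y * d) * (y - d * y)
        - c *\<^sub>C (star y * a) * c *\<^sub>C (a * y)
        + (star y - star y * d) * c *\<^sub>C (a * y) - c *\<^sub>C (star y * a) * (y - d * y)"
      by simp
    also have "c *\<^sub>C (star y * a) * c *\<^sub>C (a * y) = - (star y * (a * (a * y)))"
      by (simp add: mult_scaleC_left mult_scaleC_right scaleC_scaleC c scaleC_minus_one mult.assoc)
    also have "(star y - star y * d) * c *\<^sub>C (a * y) = c *\<^sub>C (star y * (a * y) - star y * (d * a * y))"
      by (simp add: mult_scaleC_right mult.assoc left_diff_distrib scaleC_diff_right)
    also have "c *\<^sub>C (star y * a) * (y - d * y) = c *\<^sub>C (star y * (a * y) - star y * (a * d * y))"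
      by (simp add: mult_scaleC_left mult.assoc right_diff_distrib scaleC_diff_right)
    also have "(star y - star y * d) * (y - d * y) = star y * y - star y * ((d + d - d * d) * y)"
      by (simp add: algebra_simps)
    finally have "star ?u * ?u = star y * y"
      by (simp add: d(2,3) mult.assoc)
    then have "(norm ?u)\<^sup>2 = (norm y)\<^sup>2" by (metis cstar_identity)
    then show ?thesis by simp
  qed
  have C: "norm (y - d * y) \<le> norm y" for y
  proof -
    let ?v = "y - d * y" and ?w = "\<i> *\<^sub>C (a * y)"
    have "2 * norm ?v = norm ((?v + ?w) + (?v + (- \<i>) *\<^sub>C (a * y)))"
      by (simp add: scaleC_minus_left flip: scaleR_2)
    also have "\<dots> \<le> norm y + norm y"
      using norm_triangle_ineq[of "?v + ?w" "?v + (- \<i>) *\<^sub>C (a * y)"] U[of "\<i>" y] U[of "-\<i>" y]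
      by simp
    finally show ?thesis by simp
  qed
  have "norm (y - a * a * y) \<le> norm y" for y
  proof -
    have eq: "y - a * a * y = (y - d * y) - d * (y - d * y)"
      unfolding d(3)[symmetric] by (simp add: algebra_simps)
    show ?thesis unfolding eq using C[of "y - d * y"] C[of y] by (rule order_trans)
  qed
  then show ?thesis by (simp add: cocontraction_def star_mult sa)
qed

text \<open>As the weights sum to 1, \<open>1 - (\<Sum>n. c n *\<^sub>R e n)\<close> is formally the
  convex combination of the contractions \<open>1 - e n\<close>. Absolute convergence comes from the
  uniform bound 2 on \<open>norm (e n)\<close>.\<close>

lemma cocontraction_convex_series:
  fixes e :: "nat \<Rightarrow> 'a::cstar_algebra"
  assumes e: "\<And>n. cocontraction (e n)" and c: "\<And>n. 0 \<le> c n" "c sums (1::real)"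
  shows "summable (\<lambda>n. norm (c n *\<^sub>R e n))" "cocontraction (\<Sum>n. c n *\<^sub>R e n)"
proof -
  have "norm (norm (c n *\<^sub>R e n)) \<le> 2 * c n" for n
    using c(1)[of n] mult_left_mono[OF cocontraction_norm_le[OF e[of n]], of "c n"] by simp
  then show sn: "summable (\<lambda>n. norm (c n *\<^sub>R e n))"
    by (intro summable_comparison_test'[OF summable_mult[OF sums_summable[OF c(2)], of 2]]) auto
  then have s: "summable (\<lambda>n. c n *\<^sub>R e n)" by (rule summable_norm_cancel)
  have "norm (y - (\<Sum>n. c n *\<^sub>R e n) * y) \<le> norm y" for y
  proof -
    have "(\<lambda>n. c n *\<^sub>R y - c n *\<^sub>R e n * y) sums (1 *\<^sub>R y - (\<Sum>n. c n *\<^sub>R e n) * y)"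
      by (intro sums_diff sums_mult2 summable_sums s sums_scaleR_left c(2))
    then have "(\<lambda>n. c n *\<^sub>R (y - e n * y)) sums (y - (\<Sum>n. c n *\<^sub>R e n) * y)"
      by (simp add: scaleR_diff_right)
    moreover have "(\<lambda>n. c n * norm y) sums (1 * norm y)" by (rule sums_mult2[OF c(2)])
    moreover have "norm (c n *\<^sub>R (y - e n * y)) \<le> c n * norm y" for n
      using c(1)[of n] cocontractionD(2)[OF e] by (simp add: mult_left_mono)
    ultimately have "norm (y - (\<Sum>n. c n *\<^sub>R e n) * y) \<le> 1 * norm y"
      by (rule norm_sums_le)
    then show ?thesis by simp
  qed
  moreover have "star (\<Sum>n. c n *\<^sub>R e n) = (\<Sum>n. c n *\<^sub>R e n)"
    by (rule self_adjoint_suminf[OF _ s]) (simp add: star_scaleR cocontractionD(1)[OF e])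
  ultimately show "cocontraction (\<Sum>n. c n *\<^sub>R e n)"
    by (simp add: cocontraction_def)
qed

text \<open>Formally, \<open>copower p n = 1 - (1 - p)\<^sup>n\<close>.\<close>

primrec copower :: "'a::cstar_algebra \<Rightarrow> nat \<Rightarrow> 'a" where
  "copower p 0 = 0"
| "copower p (Suc n) = p + copower p n - p * copower p n"

text \<open>This is the law of exponents for \<open>1 - p\<close>, written without a unit:
  \<open>(1 - x)(1 - y) = 1 - (x + y - x * y)\<close>.\<close>

lemma copower_add:
  "copower p m * copower p n = copower p m + copower p n - copower p (m + n)"
proof (induction m)
  case (Suc m)
  have "copower p (Suc m) * copower p n
      = p * copower p n + copower p m * copower p n - p * (copower p m * copower p n)"
    by (simp add: algebra_simps)
  then show ?case unfolding Suc by (simp add: algebra_simps)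
qed simp

lemma copower_commute: "copower p m * copower p n = copower p n * copower p m"
  by (simp add: copower_add add.commute)

lemma copower_in_subalgebra: "closed_subalgebra S \<Longrightarrow> p \<in> S \<Longrightarrow> copower p n \<in> S"
  by (induction n) (auto simp: closed_subalgebraD)

lemma cocontraction_copower:
  assumes "cocontraction p"
  shows "cocontraction (copower p n)"
proof (induction n)
  case 0
  show ?case by (simp add: cocontraction_def)
next
  case (Suc n)
  have eq: "y - copower p (Suc n) * y = (y - copower p n * y) - p * (y - copower p n * y)" for y
    by (simp add: algebra_simps)
  have "norm (y - copower p (Suc n) * y) \<le> norm y" for y
    unfolding eq
    using cocontractionD(2)[OF assms, of "y - copower p n * y"] cocontractionD(2)[OF Suc, of y]
    by (rule order_trans)
  \<comment> \<open>\<open>copower p (Suc 0)\<close> simplifies to \<open>p\<close>, so the instance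
    below says that \<open>p\<close> commutes with \<open>copower p n\<close>; the product of the
    two is therefore self-adjoint.\<close>
  moreover have "star (copower p (Suc n)) = copower p (Suc n)"
    using copower_commute[of p "Suc 0" n]
    by (simp add: star_add star_diff star_mult cocontractionD(1)[OF Suc] cocontractionD(1)[OF assms])
  ultimately show ?case by (simp add: cocontraction_def)
qed

text \<open>The coefficients of \<open>1 - \<surd>(1 - t) = \<Sum>n. sqrt_coeff n * t ^ n\<close>.\<close>

fun sqrt_coeff :: "nat \<Rightarrow> real" where
  "sqrt_coeff n = ((if n = 1 then 1 else 0) + (\<Sum>i = 1..<n. sqrt_coeff i * sqrt_coeff (n - i))) / 2"

declare sqrt_coeff.simps [simp del]

lemma sqrt_coeff_nonneg: "0 \<le> sqrt_coeff n"
proof (induction n rule: less_induct)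
  case (less n)
  show ?case unfolding sqrt_coeff.simps[of n] by (auto intro!: sum_nonneg less mult_nonneg_nonneg)
qed

lemma sqrt_coeff_0 [simp]: "sqrt_coeff 0 = 0"
  by (subst sqrt_coeff.simps) simp

text \<open>For the generating function \<open>g = 1 - sqrt (1 - t)\<close> this is the identity
  \<open>g * g = 2 * g - t\<close>, read off coefficientwise. The end terms of the sum vanish
  because \<open>sqrt_coeff 0 = 0\<close>.\<close>

lemma sqrt_coeff_convolution:
  "(\<Sum>i\<le>k. sqrt_coeff i * sqrt_coeff (k - i)) = 2 * sqrt_coeff k - (if k = 1 then 1 else 0)"
proof -
  have "(\<Sum>i\<le>k. sqrt_coeff i * sqrt_coeff (k - i)) = (\<Sum>i=1..<k. sqrt_coeff i * sqrt_coeff (k - i))"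
  proof (rule sum.mono_neutral_right)
    show "\<forall>i\<in>{..k} - {1..<k}. sqrt_coeff i * sqrt_coeff (k - i) = 0"
    proof
      fix i assume "i \<in> {..k} - {1..<k}"
      then have "i = 0 \<or> i = k" by auto
      then show "sqrt_coeff i * sqrt_coeff (k - i) = 0" by auto
    qed
  qed auto
  then show ?thesis by (subst (2) sqrt_coeff.simps) simp
qed

text \<open>The identity \<open>2 * g = t + g * g\<close> at \<open>t = 1\<close>, for partial sums:
  positive \<open>i\<close>, \<open>j\<close> with \<open>i + j \<le> N\<close> are both below
  \<open>N\<close>, so twice the next partial sum is at most 1 plus the square of the present one,
  hence at most 2.\<close>

lemma sqrt_coeff_partial_sum_le: "(\<Sum>k<N. sqrt_coeff k) \<le> 1"
proof (induction N)
  case (Suc N)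
  let ?c = sqrt_coeff
  have "2 * (\<Sum>k<Suc N. ?c k) = (\<Sum>k<Suc N. if k = 1 then 1 else 0) + (\<Sum>k<Suc N. \<Sum>i\<le>k. ?c i * ?c (k - i))"
    by (simp only: sqrt_coeff_convolution sum_subtractf sum_distrib_left)
  also have "(\<Sum>k<Suc N. \<Sum>i\<le>k. ?c i * ?c (k - i)) = (\<Sum>(i,j)\<in>{(i,j). i + j < Suc N}. ?c i * ?c j)"
    by (rule sum.triangle_reindex[symmetric])
  also have "\<dots> = (\<Sum>(i,j)\<in>{(i,j). i + j < Suc N} \<inter> {..<N} \<times> {..<N}. ?c i * ?c j)"
  proof (rule sum.mono_neutral_right)
    show "finite {(i,j). i + j < Suc N}"
      by (rule finite_subset[of _ "{..<Suc N} \<times> {..<Suc N}"]) auto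
    show "\<forall>x\<in>{(i,j). i + j < Suc N} - {(i,j). i + j < Suc N} \<inter> {..<N} \<times> {..<N}. (case x of (i,j) \<Rightarrow> ?c i * ?c j) = 0"
    proof
      fix x assume "x \<in> {(i,j). i + j < Suc N} - {(i,j). i + j < Suc N} \<inter> {..<N} \<times> {..<N}"
      then have "fst x = 0 \<or> snd x = 0" by auto
      then show "(case x of (i,j) \<Rightarrow> ?c i * ?c j) = 0" by (auto simp: case_prod_unfold)
    qed
  qed auto
  also have "\<dots> \<le> (\<Sum>(i,j)\<in>{..<N} \<times> {..<N}. ?c i * ?c j)"
    by (rule sum_mono2) (auto intro!: mult_nonneg_nonneg sqrt_coeff_nonneg)
  also have "\<dots> = (\<Sum>k<N. ?c k) * (\<Sum>k<N. ?c k)"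
    by (simp add: sum_product sum.cartesian_product)
  also have "\<dots> \<le> 1"
    using Suc by (intro mult_le_one sum_nonneg sqrt_coeff_nonneg) auto
  also have "(\<Sum>k<Suc N. if k = 1 then 1 else 0) \<le> (1::real)"
    by (simp add: sum.delta del: sum.lessThan_Suc)
  finally show ?case by simp
qed simp

text \<open>The Cauchy product turns the convolution identity into a quadratic equation for the sum,
  with 1 as its double root.\<close>

lemma sqrt_coeff_sums: "sqrt_coeff sums 1"
proof -
  let ?c = sqrt_coeff
  have s: "summable ?c"
    by (rule summableI_nonneg_bounded[where x = 1])
      (auto simp: sqrt_coeff_nonneg sqrt_coeff_partial_sum_le)
  have s': "summable (\<lambda>k. norm (?c k))" using s by (simp add: sqrt_coeff_nonneg)
  have "(\<lambda>k. \<Sum>i\<le>k. ?c i * ?c (k - i)) sums (suminf ?c * suminf ?c)"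
    by (rule Cauchy_product_sums[OF s' s'])
  moreover have "(\<lambda>k. 2 * ?c k - (if k = 1 then 1 else 0)) sums (2 * suminf ?c - 1)"
    using sums_single[of 1 "\<lambda>_. 1::real"] 
    by (intro sums_diff sums_mult summable_sums s) simp
  ultimately have "suminf ?c * suminf ?c = 2 * suminf ?c - 1"
    by (simp add: sqrt_coeff_convolution sums_unique2)
  then have "(suminf ?c - 1) * (suminf ?c - 1) = 0" by (simp add: algebra_simps)
  then have "suminf ?c = 1" by simp
  then show ?thesis using summable_sums[OF s] by simp
qed

text \<open>The square root of \<open>p = 1 - (1 - p)\<close> by the binomial series in \<open>1 - p\<close>.\<close>

lemma cocontraction_sqrt:
  fixes p :: "'a::cstar_algebra"
  assumes p: "cocontraction p"
  obtains r where "cocontraction r" "r * r = p"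
    "\<And>S. closed_subalgebra S \<Longrightarrow> p \<in> S \<Longrightarrow> r \<in> S"
proof -
  let ?c = sqrt_coeff
  let ?e = "copower p"
  define r where "r = (\<Sum>n. ?c n *\<^sub>R ?e n)"
  note e = cocontraction_copower[OF p]
  note ser = cocontraction_convex_series[OF e sqrt_coeff_nonneg sqrt_coeff_sums]
  note s = summable_norm_cancel[OF ser(1)]
  have "r \<in> S" if "closed_subalgebra S" "p \<in> S" for S
    unfolding r_def
    by (intro closed_subalgebra_suminf[OF that(1)] s closed_subalgebraD(7)[OF that(1)] copower_in_subalgebra that)
  moreover have "r * r = p"
  proof -
    define R where "R N = (\<Sum>n<N. ?c n *\<^sub>R ?e n)" for N
    define C where "C N = (\<Sum>n<N. ?c n)" for N
    define V where "V N = (\<Sum>k<N. \<Sum>i\<le>k. ?c i * ?c (k - i))" for N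
    define W where "W N = (\<Sum>k<N. (\<Sum>i\<le>k. ?c i * ?c (k - i)) *\<^sub>R ?e k)" for N
    have R: "R \<longlonglongrightarrow> r" unfolding R_def[abs_def] r_def by (rule summable_LIMSEQ[OF s])
    have C: "C \<longlonglongrightarrow> 1" using sqrt_coeff_sums by (simp add: C_def[abs_def] sums_def)
    have "(\<lambda>k. 2 * ?c k - (if k = 1 then 1 else 0)) sums (2 * 1 - 1)"
      using sums_single[of 1 "\<lambda>_. 1::real"]
      by (intro sums_diff sums_mult sqrt_coeff_sums) simp
    then have V: "V \<longlonglongrightarrow> 1" by (simp add: V_def[abs_def] sqrt_coeff_convolution sums_def)
    have "(\<lambda>k. if k = 1 then ?e k else 0) sums ?e 1"
      using sums_single[of 1 ?e] by simp
    then have "(\<lambda>k. 2 *\<^sub>R (?c k *\<^sub>R ?e k) - (if k = 1 then ?e k else 0)) sums (2 *\<^sub>R r - ?e 1)"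
      unfolding r_def by (intro sums_diff sums_scaleR_right summable_sums[OF s])
    moreover have "2 *\<^sub>R (?c k *\<^sub>R ?e k) - (if k = 1 then ?e k else 0) = (\<Sum>i\<le>k. ?c i * ?c (k - i)) *\<^sub>R ?e k" for k
      by (simp add: sqrt_coeff_convolution algebra_simps)
    ultimately have W: "W \<longlonglongrightarrow> 2 *\<^sub>R r - p"
      by (simp add: W_def[abs_def] sums_def)
    \<comment> \<open>By \<open>copower_add\<close> the square of the partial sum \<open>R N\<close>
      is \<open>2 *\<^sub>R (C N *\<^sub>R R N) - D N\<close>, where \<open>D N\<close> runs over a
      square of index pairs. \<open>W N\<close> is the same sum over the triangle
      \<open>i + j < N\<close>, and its limit is already known.\<close>
    define D where "D N = (\<Sum>(i,j)\<in>{..<N} \<times> {..<N}. (?c i * ?c j) *\<^sub>R ?e (i + j))" for N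
    have RR: "R N * R N = 2 *\<^sub>R (C N *\<^sub>R R N) - D N" for N
    proof -
      have "R N * R N = (\<Sum>(i,j)\<in>{..<N} \<times> {..<N}. (?c i * ?c j) *\<^sub>R (?e i + ?e j - ?e (i + j)))"
        by (simp add: R_def sum_product sum.cartesian_product copower_add mult.commute)
      also have "\<dots> = (\<Sum>(i,j)\<in>{..<N} \<times> {..<N}. ?c j *\<^sub>R ?c i *\<^sub>R ?e i)
          + (\<Sum>(i,j)\<in>{..<N} \<times> {..<N}. ?c i *\<^sub>R ?c j *\<^sub>R ?e j) - D N"
        unfolding D_def sum.distrib[symmetric] sum_subtractf[symmetric]
        by (rule sum.cong)
          (auto simp: scaleR_right_diff_distrib scaleR_right_distrib mult.commute)
      also have "(\<Sum>(i,j)\<in>{..<N} \<times> {..<N}. ?c j *\<^sub>R ?c i *\<^sub>R ?e i)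
          = (\<Sum>(i,j)\<in>{..<N} \<times> {..<N}. ?c i *\<^sub>R ?c j *\<^sub>R ?e j)"
        unfolding sum.cartesian_product[symmetric] by (rule sum.swap)
      also have "\<dots> = (\<Sum>i<N. ?c i *\<^sub>R R N)"
        by (simp add: R_def scaleR_sum_right sum.cartesian_product)
      also have "\<dots> = C N *\<^sub>R R N"
        by (simp add: C_def scaleR_sum_left)
      finally show ?thesis unfolding scaleR_2 .
    qed
    \<comment> \<open>The pairs in the square but outside the triangle have total weight
      \<open>C N * C N - V N\<close>, which tends to \<open>1 - 1\<close>; the factor 2 bounds each
      \<open>copower\<close>.\<close>
    have "norm (D N - W N) \<le> 2 * (C N * C N - V N)" for N
    proof -
      let ?Q = "{..<N} \<times> {..<N}" and ?T = "{(i,j). i + j < N}"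
      have sub: "?T \<subseteq> ?Q" by auto
      have "W N = (\<Sum>(i,j)\<in>?T. (?c i * ?c j) *\<^sub>R ?e (i + j))"
        unfolding sum.triangle_reindex W_def by (simp add: scaleR_sum_left)
      then have "D N - W N = (\<Sum>(i,j)\<in>?Q - ?T. (?c i * ?c j) *\<^sub>R ?e (i + j))"
        unfolding D_def by (simp add: sum_diff sub)
      also have "norm \<dots> \<le> (\<Sum>(i,j)\<in>?Q - ?T. 2 * (?c i * ?c j))"
      proof (rule sum_norm_le)
        fix x :: "nat \<times> nat"
        obtain i j where x: "x = (i, j)" by (cases x)
        show "norm (case x of (i, j) \<Rightarrow> (?c i * ?c j) *\<^sub>R ?e (i + j)) \<le> (case x of (i, j) \<Rightarrow> 2 * (?c i * ?c j))"
          using mult_left_mono[OF cocontraction_norm_le[OF e[of "i + j"]], of "?c i * ?c j"]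
          by (simp add: x sqrt_coeff_nonneg abs_mult)
      qed
      also have "\<dots> = 2 * ((\<Sum>(i,j)\<in>?Q. ?c i * ?c j) - (\<Sum>(i,j)\<in>?T. ?c i * ?c j))"
        unfolding case_prod_unfold sum_distrib_left[symmetric]
        using sum_diff[OF _ sub[unfolded case_prod_unfold], of "\<lambda>x. ?c (fst x) * ?c (snd x)"] by simp
      also have "(\<Sum>(i,j)\<in>?T. ?c i * ?c j) = V N"
        unfolding sum.triangle_reindex V_def ..
      also have "(\<Sum>(i,j)\<in>?Q. ?c i * ?c j) = C N * C N"
        by (simp add: C_def sum_product sum.cartesian_product)
      finally show ?thesis .
    qed
    then have "\<forall>\<^sub>F N in sequentially. norm (D N - W N) \<le> 2 * (C N * C N - V N)" by simp
    moreover have "(\<lambda>N. 2 * (C N * C N - V N)) \<longlonglongrightarrow> 2 * (1 * 1 - 1)"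
      by (intro tendsto_intros C V)
    then have "(\<lambda>N. 2 * (C N * C N - V N)) \<longlonglongrightarrow> 0" by simp
    ultimately have "(\<lambda>N. D N - W N) \<longlonglongrightarrow> 0" by (rule Lim_null_comparison)
    from tendsto_add[OF this W] have D: "D \<longlonglongrightarrow> 2 *\<^sub>R r - p" by simp
    have "(\<lambda>N. R N * R N) \<longlonglongrightarrow> 2 *\<^sub>R (1 *\<^sub>R r) - (2 *\<^sub>R r - p)"
      unfolding RR by (intro tendsto_intros C R D)
    moreover have "(\<lambda>N. R N * R N) \<longlonglongrightarrow> r * r" by (intro tendsto_intros R)
    ultimately have "r * r = 2 *\<^sub>R (1 *\<^sub>R r) - (2 *\<^sub>R r - p)" by (rule LIMSEQ_unique[rotated])
    then show ?thesis by simp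
  qed
  moreover have "cocontraction r" unfolding r_def by (rule ser(2))
  ultimately show ?thesis using that[of r] by simp
qed

section \<open>Approximate units and factorization\<close>

text \<open>For these means the bound below on \<open>p - cesaro p n * p\<close> is a telescoping sum.\<close>

definition cesaro :: "'a::cstar_algebra \<Rightarrow> nat \<Rightarrow> 'a" where
  "cesaro p n = (1 / real (Suc n)) *\<^sub>R (\<Sum>k<Suc n. copower p k)"

lemma cesaro_in_subalgebra: "closed_subalgebra S \<Longrightarrow> p \<in> S \<Longrightarrow> cesaro p n \<in> S"
  unfolding cesaro_def
  by (intro closed_subalgebraD(7) subspace_sum copower_in_subalgebra) (auto dest: closed_subalgebraD(1))

lemma cesaro_self_adjoint:
  assumes "cocontraction p"
  shows "star (cesaro p n) = cesaro p n"
proof -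
  have "star (\<Sum>k<m. copower p k) = (\<Sum>k<m. copower p k)" for m
    by (induction m) (simp_all add: star_add cocontractionD(1)[OF cocontraction_copower[OF assms]])
  then show ?thesis by (simp only: cesaro_def star_scaleR)
qed

lemma norm_cesaro_le:
  assumes "cocontraction p"
  shows "norm (cesaro p n) \<le> 2"
proof -
  have "norm (\<Sum>k<Suc n. copower p k) \<le> of_nat (card {..<Suc n}) * 2"
    by (rule sum_norm_bound) (rule cocontraction_norm_le[OF cocontraction_copower[OF assms]])
  then show ?thesis by (simp add: cesaro_def divide_simps del: sum.lessThan_Suc)
qed

lemma norm_diff_cesaro_le:
  assumes "cocontraction p"
  shows "norm (p - cesaro p n * p) \<le> 2 / real (Suc n)"
proof -
  have step: "p - copower p k * p = copower p (Suc k) - copower p k" for k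
    using copower_commute[of p k "Suc 0"] by simp
  have "(\<Sum>k<Suc n. p) = real (Suc n) *\<^sub>R p" by (subst sum_constant_scaleR) simp
  then have "p - cesaro p n * p = (1 / real (Suc n)) *\<^sub>R (\<Sum>k<Suc n. p - copower p k * p)"
    by (simp add: cesaro_def sum_subtractf sum_distrib_right scaleR_diff_right del: sum.lessThan_Suc)
  also have "(\<Sum>k<Suc n. p - copower p k * p) = copower p (Suc n)"
    unfolding step by (simp only: sum_lessThan_telescope copower.simps(1) diff_zero)
  finally show ?thesis
    using cocontraction_norm_le[OF cocontraction_copower[OF assms], of "Suc n"]
    by (simp add: divide_simps del: copower.simps)
qed

text \<open>With \<open>e = cesaro p n\<close>, the C*-identity gives the square of
  \<open>norm (x - e * x)\<close> as the norm of the formal product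
  \<open>(1 - e) p (1 - e)\<close>, which \<open>norm_diff_cesaro_le\<close> controls. The factor 3
  is 1 plus the bound 2 on \<open>norm e\<close>.\<close>

lemma cesaro_tendsto:
  fixes x :: "'a::cstar_algebra"
  assumes p: "cocontraction p" and x: "x * star x = p"
  shows "(\<lambda>n. cesaro p n * x) \<longlonglongrightarrow> x"
proof -
  have le: "norm (x - cesaro p n * x) \<le> sqrt (3 * (2 / real (Suc n)))" for n
  proof -
    let ?e = "cesaro p n" and ?u = "x - cesaro p n * x"
    have "star ?u = star x - star x * ?e"
      by (simp add: star_diff star_mult cesaro_self_adjoint[OF p])
    then have "?u * star ?u = (x - ?e * x) * (star x - star x * ?e)" by simp
    also have "\<dots> = (p - ?e * p) - (p - ?e * p) * ?e"
      unfolding x[symmetric] by (simp add: algebra_simps)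
    finally have "(norm ?u)\<^sup>2 \<le> norm (p - ?e * p) + norm ((p - ?e * p) * ?e)"
      by (metis cstar_identity' norm_triangle_ineq4)
    also have "norm ((p - ?e * p) * ?e) \<le> norm (p - ?e * p) * norm ?e" by (rule norm_mult_ineq)
    also have "\<dots> \<le> norm (p - ?e * p) * 2"
      by (intro mult_left_mono norm_cesaro_le p) simp
    also have "norm (p - ?e * p) + norm (p - ?e * p) * 2 \<le> 3 * (2 / real (Suc n))"
      using norm_diff_cesaro_le[OF p, of n] by simp
    finally show ?thesis by (intro real_le_rsqrt) simp
  qed
  have "(\<lambda>n. 2 / real (Suc n)) \<longlonglongrightarrow> 0"
    using tendsto_mult_right[OF LIMSEQ_Suc[OF lim_1_over_n], of 2] by simp
  then have "(\<lambda>n. sqrt (3 * (2 / real (Suc n)))) \<longlonglongrightarrow> sqrt (3 * 0)"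
    by (intro tendsto_intros)
  then have "(\<lambda>n. sqrt (3 * (2 / real (Suc n)))) \<longlonglongrightarrow> 0" by simp
  then have "(\<lambda>n. x - cesaro p n * x) \<longlonglongrightarrow> 0"
    by (rule Lim_null_comparison[rotated]) (simp only: le eventually_True)
  from tendsto_diff[OF tendsto_const[of x] this] show ?thesis by simp
qed

text \<open>Here \<open>r\<close> is the absolute value of \<open>a\<close> and \<open>q\<close> its
  square root, so that \<open>z\<close> should be the sign of \<open>a\<close> times
  \<open>q\<close>. It is obtained as the limit of \<open>a * w n\<close>, where
  \<open>r * w n\<close> tends to \<open>q\<close>: multiplying by \<open>a\<close> or by
  \<open>r\<close> gives the same norms.\<close>

lemma self_adjoint_factorization_aux:
  fixes a :: "'a::cstar_algebra"
  assumes S: "closed_subalgebra S" and a: "a \<in> S" "star a = a" "norm a < 1"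
  obtains q z where "q \<in> S" "z \<in> S" "star q = q" "q * z = a" "norm q * norm z = norm a"
proof -
  \<comment> \<open>Working inside the centralizer yields \<open>q * a = a * q\<close>, needed at
    the end to identify \<open>q * z\<close>.\<close>
  define C where "C = S \<inter> {y. y * a = a * y}"
  have C: "closed_subalgebra C"
    unfolding C_def by (intro closed_subalgebra_Int S closed_subalgebra_centralizer)
  have aC: "a * a \<in> C"
    by (simp add: C_def a closed_subalgebraD(4)[OF S] mult.assoc)
  obtain r where r: "cocontraction r" "r * r = a * a" and rC: "r \<in> C"
    using cocontraction_sqrt[OF cocontraction_square[OF a(2,3)]] C aC by metis
  obtain q where q: "cocontraction q" "q * q = r" and qC: "q \<in> C"
    using cocontraction_sqrt[OF r(1)] C rC by metis
  note sr = cocontractionD(1)[OF r(1)] and sq = cocontractionD(1)[OF q(1)]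
  \<comment> \<open>Formally \<open>copower r k\<close> is \<open>r\<close> times a polynomial in
    \<open>r\<close> which may have a constant term; multiplying by \<open>q\<close> keeps the
    quotient inside the algebra.\<close>
  have "\<exists>w\<in>C. copower r k * q = r * w" for k
  proof (induction k)
    case 0
    show ?case using closed_subalgebraD(3)[OF C] by (auto intro: bexI[of _ 0])
  next
    case (Suc k)
    then obtain w where w: "w \<in> C" "copower r k * q = r * w" by blast
    have "copower r (Suc k) * q = r * (q + w - copower r k * q)"
      using w(2) by (simp add: algebra_simps)
    moreover have "q + w - copower r k * q \<in> C"
      by (intro closed_subalgebraD[OF C] copower_in_subalgebra C w qC rC)
    ultimately show ?case by blast
  qed
  then obtain v where v: "\<And>k. v k \<in> C" "\<And>k. copower r k * q = r * v k" by metis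
  define w where "w n = (1 / real (Suc n)) *\<^sub>R (\<Sum>k<Suc n. v k)" for n
  have wC: "w n \<in> C" for n
    unfolding w_def by (intro closed_subalgebraD(7)[OF C] subspace_sum closed_subalgebraD(1)[OF C] v)
  have "cesaro r n * q = r * w n" for n
    by (simp add: cesaro_def w_def sum_distrib_left sum_distrib_right v(2) del: sum.lessThan_Suc)
  then have rw: "(\<lambda>n. r * w n) \<longlonglongrightarrow> q"
    using cesaro_tendsto[OF r(1), of q] by (simp add: sq q)
  \<comment> \<open>\<open>star (a * y) * (a * y)\<close> involves \<open>a\<close> only through
    \<open>a * a\<close>, which equals \<open>r * r\<close>.\<close>
  have abs: "norm (a * y) = norm (r * y)" for y
  proof -
    have "star (a * y) * (a * y) = star y * (a * a) * y" by (simp add: star_mult a mult.assoc)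
    also have "\<dots> = star (r * y) * (r * y)" by (simp add: star_mult sr mult.assoc flip: r(2))
    finally have "(norm (a * y))\<^sup>2 = (norm (r * y))\<^sup>2" by (metis cstar_identity)
    then show ?thesis by simp
  qed
  \<comment> \<open>The same comparison for the formal element \<open>y - 1\<close>; it is applied
    to \<open>y = q * w n\<close>.\<close>
  have abs1: "norm (a * y - a) = norm (r * y - r)" for y
  proof -
    have "star (c * y - c) * (c * y - c) = star y * (c * c) * y - star y * (c * c) - (c * c) * y + c * c"
      if "star c = c" for c
      by (simp add: star_mult star_diff that algebra_simps)
    from this[OF a(2)] this[OF sr]
    have "(norm (a * y - a))\<^sup>2 = (norm (r * y - r))\<^sup>2" unfolding r(2) by (metis cstar_identity)
    then show ?thesis by simp
  qed
  have "Cauchy (\<lambda>n. a * w n)"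
  proof -
    have "dist (a * w m) (a * w n) = dist (r * w m) (r * w n)" for m n
      using abs[of "w m - w n"] by (simp add: dist_norm right_diff_distrib)
    then show ?thesis using LIMSEQ_imp_Cauchy[OF rw] by (simp add: Cauchy_def)
  qed
  then obtain z where z: "(\<lambda>n. a * w n) \<longlonglongrightarrow> z" by (metis Cauchy_convergent convergent_def)
  have "z \<in> S"
    using wC by (intro closed_sequentially[OF closed_subalgebraD(2)[OF S] _ z])
      (auto simp: C_def a closed_subalgebraD(4)[OF S])
  moreover have "norm z = norm q"
    using LIMSEQ_unique[OF tendsto_norm[OF z]] tendsto_norm[OF rw] by (simp add: abs)
  then have "norm q * norm z = norm r"
    using norm_mult_self_adjoint[OF sq] by (simp add: q power2_eq_square)
  moreover have "(norm r)\<^sup>2 = (norm a)\<^sup>2"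
    using norm_mult_self_adjoint[OF sr] norm_mult_self_adjoint[OF a(2)] r(2) by simp
  then have "norm r = norm a" by simp
  moreover have "q * z = a"
  proof (rule LIMSEQ_unique)
    show "(\<lambda>n. q * (a * w n)) \<longlonglongrightarrow> q * z" by (intro tendsto_intros z)
    have "q * a = a * q" using qC by (simp add: C_def)
    then have eq: "q * (a * w n) = a * (q * w n)" for n by (metis mult.assoc)
    have "r * (q * w n) = q * (r * w n)" for n by (simp add: q(2)[symmetric] mult.assoc)
    then have "(\<lambda>n. norm (r * (q * w n) - r)) \<longlonglongrightarrow> norm (q * q - r)"
      by (simp only:) (intro tendsto_intros rw)
    then have "(\<lambda>n. norm (q * (a * w n) - a)) \<longlonglongrightarrow> 0" by (simp add: q eq abs1)
    then show "(\<lambda>n. q * (a * w n)) \<longlonglongrightarrow> a"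
      using LIM_zero_iff tendsto_norm_zero_iff by blast
  qed
  ultimately show ?thesis using that[of q z] qC sq by (simp add: C_def)
qed

lemma self_adjoint_factorization:
  fixes a :: "'a::cstar_algebra"
  assumes S: "closed_subalgebra S" and a: "a \<in> S" "star a = a"
  obtains q z where "q \<in> S" "z \<in> S" "star q = q" "q * z = a" "norm q * norm z = norm a"
proof -
  define t where "t = 2 * norm a + 1"
  have t: "t > 0" and lt: "norm a < t" unfolding t_def using norm_ge_zero[of a] by linarith+
  have "norm ((1 / t) *\<^sub>R a) < 1" using t lt by simp
  then obtain q z where qz: "q \<in> S" "z \<in> S" "star q = q" "q * z = (1 / t) *\<^sub>R a"
    "norm q * norm z = norm ((1 / t) *\<^sub>R a)"
    using self_adjoint_factorization_aux[OF S, of "(1 / t) *\<^sub>R a"] a closed_subalgebraD(7)[OF S]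
    by (metis star_scaleR)
  show ?thesis
  proof (rule that[of q "t *\<^sub>R z"])
    show "q * t *\<^sub>R z = a" using t by (simp add: qz)
    have "norm q * norm (t *\<^sub>R z) = t * (norm q * norm z)" using t by simp
    also have "\<dots> = norm a" using t by (simp add: qz)
    finally show "norm q * norm (t *\<^sub>R z) = norm a" .
  qed (use qz closed_subalgebraD(7)[OF S] in auto)
qed

section \<open>Closed ideals: stability under the involution and factorization\<close>

lemma closed_subalgebra_ideal:
  "closed_two_sided_ideal J B \<Longrightarrow> closed_subalgebra J"
  unfolding closed_two_sided_ideal_def closed_subalgebra_def complex_subspace_def subspace_def
  by (auto simp: scaleR_scaleC)

text \<open>For \<open>a = y * star y\<close> the means \<open>e\<close> of \<open>a * a\<close> are
  self-adjoint elements of \<open>J\<close> with \<open>e * y\<close> tending to \<open>y\<close>.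
  Hence \<open>star y\<close> is the limit of \<open>star y * e\<close>, and these products lie in
  \<open>J\<close> because \<open>star y\<close> lies in \<open>B\<close>.\<close>

lemma ideal_star_closed:
  assumes B: "closed_star_subalgebra B" and J: "closed_two_sided_ideal J B" and x: "x \<in> J"
  shows "star x \<in> J"
proof -
  note SJ = closed_subalgebra_ideal[OF J]
  have JB: "y * b \<in> J" "b * y \<in> J" if "y \<in> J" "b \<in> B" for y b
    using J that by (auto simp: closed_two_sided_ideal_def)
  have Bstar: "star b \<in> B" if "b \<in> B" for b
    using B that by (auto simp: closed_star_subalgebra_def)
  have small: "star y \<in> J" if y: "y \<in> J" "norm y < 1" for y
  proof -
    define a where "a = y * star y"
    have sa: "star a = a" by (simp add: a_def star_mult star_star)
    have yB: "y \<in> B" using J y by (auto simp: closed_two_sided_ideal_def)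
    have aJ: "a \<in> J" unfolding a_def by (rule JB(1)[OF y(1) Bstar[OF yB]])
    have "norm a < 1" using y abs_square_less_1[of "norm y"] by (simp add: a_def cstar_identity')
    note p = cocontraction_square[OF sa this]
    \<comment> \<open>\<open>cocontraction_square\<close> applies to squares, so the means are those
      of \<open>a * a\<close>; they act as approximate unit on \<open>a\<close>, and the estimate
      for \<open>?u\<close> carries this over to \<open>y\<close>.\<close>
    let ?e = "cesaro (a * a)"
    have "(\<lambda>n. a - ?e n * a) \<longlonglongrightarrow> a - a"
      by (intro tendsto_intros cesaro_tendsto p) (simp add: sa)
    from tendsto_real_sqrt[OF tendsto_mult_left[OF tendsto_norm[OF this], of 3]]
    have lim: "(\<lambda>n. sqrt (3 * norm (a - ?e n * a))) \<longlonglongrightarrow> 0" by simp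
    have "norm (y - ?e n * y) \<le> sqrt (3 * norm (a - ?e n * a))" for n
    proof -
      let ?u = "y - ?e n * y"
      have "star ?u = star y - star y * ?e n"
        by (simp add: star_diff star_mult cesaro_self_adjoint[OF p])
      then have "?u * star ?u = (y - ?e n * y) * (star y - star y * ?e n)" by simp
      also have "\<dots> = (a - ?e n * a) - (a - ?e n * a) * ?e n"
        unfolding a_def by (simp add: algebra_simps)
      finally have "(norm ?u)\<^sup>2 \<le> norm (a - ?e n * a) + norm ((a - ?e n * a) * ?e n)"
        by (metis cstar_identity' norm_triangle_ineq4)
      also have "norm ((a - ?e n * a) * ?e n) \<le> norm (a - ?e n * a) * norm (?e n)"
        by (rule norm_mult_ineq)
      also have "\<dots> \<le> norm (a - ?e n * a) * 2"
        by (intro mult_left_mono norm_cesaro_le p) simp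
      finally show ?thesis by (intro real_le_rsqrt) simp
    qed
    then have "(\<lambda>n. y - ?e n * y) \<longlonglongrightarrow> 0"
      by (intro Lim_null_comparison[OF _ lim]) simp
    from tendsto_diff[OF tendsto_const[of y] this] have "(\<lambda>n. ?e n * y) \<longlonglongrightarrow> y" by simp
    then have "(\<lambda>n. star (?e n * y)) \<longlonglongrightarrow> star y"
      by (rule bounded_linear.tendsto[OF bounded_linear_star])
    moreover have "star (?e n * y) \<in> J" for n
      unfolding star_mult cesaro_self_adjoint[OF p]
      by (intro JB(2)[OF _ Bstar[OF yB]] cesaro_in_subalgebra[OF SJ] closed_subalgebraD(4)[OF SJ] aJ)
    ultimately show ?thesis
      by (rule closed_sequentially[OF closed_subalgebraD(2)[OF SJ], rotated])
  qed
  define t where "t = 2 * norm x + 1"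
  have t: "t > 0" and lt: "norm x < t" unfolding t_def using norm_ge_zero[of x] by linarith+
  have "norm ((1 / t) *\<^sub>R x) < 1" using t lt by simp
  then have "star ((1 / t) *\<^sub>R x) \<in> J" by (intro small closed_subalgebraD(7)[OF SJ] x)
  then have "t *\<^sub>R star ((1 / t) *\<^sub>R x) \<in> J" by (intro closed_subalgebraD(7)[OF SJ])
  then show ?thesis using t by (simp add: star_scaleR)
qed

lemma ideal_cartesian_decomposition:
  assumes B: "closed_star_subalgebra B" and J: "closed_two_sided_ideal J B" and x: "x \<in> J"
  obtains h k where "h \<in> J" "k \<in> J" "star h = h" "star k = k" "x = h + \<i> *\<^sub>C k"
    "norm h \<le> norm x" "norm k \<le> norm x"
proof -
  have s: "star x \<in> J" by (rule ideal_star_closed[OF assms])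
  note SJ = closed_subalgebra_ideal[OF J]
  have cJ: "c *\<^sub>C y \<in> J" if "y \<in> J" for c y
    using J that by (auto simp: closed_two_sided_ideal_def complex_subspace_def)
  show ?thesis
  proof (rule that[of "(1/2) *\<^sub>R (x + star x)" "(1/2) *\<^sub>R (- \<i>) *\<^sub>C (x - star x)"])
    have "\<i> *\<^sub>C (1/2::real) *\<^sub>R (- \<i>) *\<^sub>C (x - star x) = (1/2::real) *\<^sub>R (x - star x)"
      by (simp add: scaleR_scaleC scaleC_scaleC)
    then show "x = (1/2) *\<^sub>R (x + star x) + \<i> *\<^sub>C (1/2) *\<^sub>R (- \<i>) *\<^sub>C (x - star x)"
      by (simp add: scaleR_add_right[symmetric] del: scaleR_add_right)
    show "star ((1/2) *\<^sub>R (- \<i>) *\<^sub>C (x - star x)) = (1/2) *\<^sub>R (- \<i>) *\<^sub>C (x - star x)"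
      by (simp add: star_scaleR star_scaleC star_diff star_star scaleC_minus_left scaleC_diff_right)
    show "star ((1/2) *\<^sub>R (x + star x)) = (1/2) *\<^sub>R (x + star x)"
      by (simp add: star_scaleR star_add star_star add.commute)
    show "norm ((1/2) *\<^sub>R (x + star x)) \<le> norm x"
      using norm_triangle_ineq[of x "star x"] by (simp add: norm_star)
    show "norm ((1/2) *\<^sub>R (- \<i>) *\<^sub>C (x - star x)) \<le> norm x"
      using norm_triangle_ineq4[of x "star x"] by (simp add: norm_star norm_scaleC)
  qed (intro closed_subalgebraD[OF SJ] cJ x s)+
qed

text \<open>The real and imaginary parts are factored separately, and the imaginary unit is absorbed
  into \<open>z'\<close>. With a factor from \<open>J\<close> on either side, \<open>\<phi>\<close>
  can later be moved onto the left or the right factor.\<close>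

lemma ideal_factorization:
  assumes B: "closed_star_subalgebra B" and J: "closed_two_sided_ideal J B" and x: "x \<in> J"
  obtains q z q' z' where "q \<in> J" "z \<in> J" "q' \<in> J" "z' \<in> J" "x = q * z + q' * z'"
    "norm q * norm z \<le> norm x" "norm q' * norm z' \<le> norm x"
proof -
  note SJ = closed_subalgebra_ideal[OF J]
  from ideal_cartesian_decomposition[OF assms] obtain h k where hk: "h \<in> J" "k \<in> J"
    "star h = h" "star k = k" "x = h + \<i> *\<^sub>C k" "norm h \<le> norm x" "norm k \<le> norm x" .
  obtain q z where qz: "q \<in> J" "z \<in> J" "q * z = h" "norm q * norm z = norm h"
    using self_adjoint_factorization[OF SJ hk(1,3)] by metis
  obtain q' z' where qz': "q' \<in> J" "z' \<in> J" "q' * z' = k" "norm q' * norm z' = norm k"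
    using self_adjoint_factorization[OF SJ hk(2,4)] by metis
  show ?thesis
  proof (rule that[of q z q' "\<i> *\<^sub>C z'"])
    show "\<i> *\<^sub>C z' \<in> J"
      using J qz'(2) by (auto simp: closed_two_sided_ideal_def complex_subspace_def)
    show "x = q * z + q' * \<i> *\<^sub>C z'" by (simp add: hk qz qz' mult_scaleC_right)
    show "norm q' * norm (\<i> *\<^sub>C z') \<le> norm x" using hk qz' by (simp add: norm_scaleC)
  qed (use hk qz qz' in simp_all)
qed

section \<open>Boundedness of virtual commutants\<close>

text \<open>Banach-Steinhaus by Baire category, relative to a closed subspace because the ideal is a
  set and not a type. The closed sets \<open>T n\<close> cover \<open>J\<close>, so one of them
  contains a relative ball, and translation moves that ball to the origin.\<close>

lemma uniform_boundedness_on_closed_subspace: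
  fixes F :: "'i \<Rightarrow> 'a::banach \<Rightarrow> 'b::real_normed_vector"
  assumes J: "subspace J" "closed J" and F: "\<And>i. i \<in> I \<Longrightarrow> bounded_linear (F i)"
    and bdd: "\<And>x. x \<in> J \<Longrightarrow> \<exists>M. \<forall>i\<in>I. norm (F i x) \<le> M"
  obtains C where "0 \<le> C" "\<And>i x. i \<in> I \<Longrightarrow> x \<in> J \<Longrightarrow> norm (F i x) \<le> C * norm x"
proof -
  define T where "T n = {x\<in>J. \<forall>i\<in>I. norm (F i x) \<le> real n}" for n
  have clT: "closed (T n)" for n
  proof -
    have "closed (J \<inter> (\<Inter>i\<in>I. {x. norm (F i x) \<le> real n}))"
      by (intro closed_Int J closed_INT ballI closed_Collect_le continuous_intros
          bounded_linear.continuous_on[OF F])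
    moreover have "J \<inter> (\<Inter>i\<in>I. {x. norm (F i x) \<le> real n}) = T n" by (auto simp: T_def)
    ultimately show ?thesis by simp
  qed
  have clo: "closedin (top_of_set J) (T n)" for n
    by (rule closed_subset[OF _ clT]) (auto simp: T_def)
  have UT: "\<Union>(range T) = J"
  proof -
    have "\<exists>n. x \<in> T n" if x: "x \<in> J" for x
    proof -
      obtain M where M: "\<forall>i\<in>I. norm (F i x) \<le> M" using bdd[OF x] by blast
      obtain n where "M \<le> real n" using real_arch_simple by blast
      with M x have "x \<in> T n" unfolding T_def by (auto intro: order_trans)
      then show ?thesis ..
    qed
    then show ?thesis by (auto simp: T_def)
  qed
  have "\<exists>n. top_of_set J interior_of T n \<noteq> {}"
  proof (rule ccontr)
    assume "\<not> ?thesis"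
    then have "top_of_set J interior_of \<Union>(range T) = {}"
      by (intro Baire_category_alt disjI1 completely_metrizable_space_closedin
          completely_metrizable_space_euclidean)
        (auto simp: J clo)
    then have "J = {}" unfolding UT by (metis interior_of_topspace topspace_euclidean_subtopology)
    then show False using subspace_0[OF J(1)] by blast
  qed
  then obtain n x0 U where U: "openin (top_of_set J) U" "x0 \<in> U" "U \<subseteq> T n"
    by (auto simp: interior_of_def)
  then obtain e where e: "e > 0" "\<And>x. x \<in> J \<Longrightarrow> dist x x0 < e \<Longrightarrow> x \<in> T n"
    unfolding openin_euclidean_subtopology_iff by blast
  have x0: "x0 \<in> T n" using U by blast
  have small: "norm (F i x) \<le> 2 * real n" if "i \<in> I" "x \<in> J" "norm x < e" for i x
  proof -
    have "x0 + x \<in> T n"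
      using that x0 by (intro e) (auto simp: T_def dist_norm subspace_add[OF J(1)])
    then have "norm (F i (x0 + x)) \<le> real n" "norm (F i x0) \<le> real n"
      using that x0 by (auto simp: T_def)
    moreover have "F i x = F i (x0 + x) - F i x0"
      by (simp add: linear_simps[OF F[OF that(1)]])
    ultimately show ?thesis using norm_triangle_ineq4[of "F i (x0 + x)" "F i x0"] by simp
  qed
  show ?thesis
  proof (rule that[of "4 * real n / e"])
    fix i x assume ix: "i \<in> I" "x \<in> J"
    show "norm (F i x) \<le> 4 * real n / e * norm x"
    proof (cases "x = 0")
      case True
      then show ?thesis by (simp add: linear_simps[OF F[OF ix(1)]])
    next
      case False
      define t where "t = e / (2 * norm x)"
      have t: "t > 0" using False e by (simp add: t_def)
      have "norm (t *\<^sub>R x) < e" using False e by (simp add: t_def)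
      then have "norm (F i (t *\<^sub>R x)) \<le> 2 * real n"
        using ix by (intro small subspace_scale[OF J(1)])
      then have "t * norm (F i x) \<le> 2 * real n"
        using t by (simp add: linear_simps[OF F[OF ix(1)]])
      then show ?thesis using False e by (simp add: t_def field_simps)
    qed
  qed (use e in simp)
qed

lemma virtual_commutantD:
  assumes "virtual_commutant B J \<phi>"
  shows "closed_two_sided_ideal J B"
    "x \<in> J \<Longrightarrow> y \<in> J \<Longrightarrow> \<phi> (x + y) = \<phi> x + \<phi> y"
    "x \<in> J \<Longrightarrow> \<phi> (c *\<^sub>C x) = c *\<^sub>C \<phi> x"
    "x \<in> J \<Longrightarrow> \<phi> (r *\<^sub>R x) = r *\<^sub>R \<phi> x"
    "x \<in> J \<Longrightarrow> b \<in> B \<Longrightarrow> \<phi> (b * x) = b * \<phi> x"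
    "x \<in> J \<Longrightarrow> b \<in> B \<Longrightarrow> \<phi> (x * b) = \<phi> x * b"
  using assms by (auto simp: virtual_commutant_def scaleR_scaleC)

text \<open>By uniform boundedness \<open>\<phi>\<close> is bounded on products, and the factorization above is
  norm-preserving.\<close>

lemma virtual_commutant_bounded:
  assumes B: "closed_star_subalgebra B" and vc: "virtual_commutant B J \<phi>"
  obtains M where "0 \<le> M" "\<And>x. x \<in> J \<Longrightarrow> norm (\<phi> x) \<le> M * norm x"
proof -
  note vcD = virtual_commutantD[OF vc]
  note J = vcD(1)
  note SJ = closed_subalgebra_ideal[OF J]
  have JB: "x \<in> B" if "x \<in> J" for x using J that by (auto simp: closed_two_sided_ideal_def)
  \<comment> \<open>Both factors lie in \<open>B\<close>, so \<open>\<phi> (e * x)\<close> may be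
    expanded on either side. This bounds \<open>\<phi> e * x\<close> pointwise in \<open>x\<close>,
    uniformly over \<open>e\<close> in the unit ball of \<open>J\<close>.\<close>
  have swap: "\<phi> e * x = e * \<phi> x" if "e \<in> J" "x \<in> J" for e x
    using vcD(5)[of x e] vcD(6)[of e x] that JB by simp
  have bl: "bounded_linear (\<lambda>x. \<phi> e * x)" for e by (rule bounded_linear_mult_right)
  have bdd: "\<exists>M. \<forall>e\<in>{e\<in>J. norm e \<le> 1}. norm (\<phi> e * x) \<le> M" if "x \<in> J" for x
  proof (intro exI ballI)
    fix e assume e: "e \<in> {e\<in>J. norm e \<le> 1}"
    then have "norm (\<phi> e * x) \<le> norm e * norm (\<phi> x)"
      using swap that norm_mult_ineq by (metis mem_Collect_eq)
    also have "\<dots> \<le> 1 * norm (\<phi> x)" using e by (intro mult_right_mono) auto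
    finally show "norm (\<phi> e * x) \<le> 1 * norm (\<phi> x)" .
  qed
  obtain C where C: "0 \<le> C"
    "\<And>e x. e \<in> {e\<in>J. norm e \<le> 1} \<Longrightarrow> x \<in> J \<Longrightarrow> norm (\<phi> e * x) \<le> C * norm x"
    using uniform_boundedness_on_closed_subspace[where F = "\<lambda>e x. \<phi> e * x" and I = "{e\<in>J. norm e \<le> 1}" and J = J]
      closed_subalgebraD(1,2)[OF SJ] bl bdd by blast
  have prod: "norm (\<phi> e * x) \<le> C * norm e * norm x" if ex: "e \<in> J" "x \<in> J" for e x
  proof (cases "e = 0")
    case True
    then show ?thesis using vcD(4)[OF ex(1), of 0] by simp
  next
    case False
    let ?e = "(1 / norm e) *\<^sub>R e"
    have "?e \<in> J" by (rule closed_subalgebraD(7)[OF SJ ex(1)])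
    then have "norm (\<phi> ?e * x) \<le> C * norm x" using False ex by (intro C) auto
    then have "norm (\<phi> e * x) / norm e \<le> C * norm x" by (simp add: vcD(4)[OF ex(1)])
    then show ?thesis using False by (simp add: field_simps)
  qed
  show ?thesis
  proof (rule that[of "2 * C"])
    fix x assume "x \<in> J"
    from ideal_factorization[OF B J this] obtain q z q' z' where qz:
      "q \<in> J" "z \<in> J" "q' \<in> J" "z' \<in> J" "x = q * z + q' * z'"
      "norm q * norm z \<le> norm x" "norm q' * norm z' \<le> norm x" .
    have "\<phi> x = \<phi> q * z + \<phi> q' * z'"
      using vcD(6)[of q z] vcD(6)[of q' z'] qz JB by (simp add: vcD(2) closed_subalgebraD(4)[OF SJ])
    then have "norm (\<phi> x) \<le> norm (\<phi> q * z) + norm (\<phi> q' * z')"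
      by (simp add: norm_triangle_ineq)
    also have "\<dots> \<le> C * (norm q * norm z) + C * (norm q' * norm z')"
      using prod[OF qz(1,2)] prod[OF qz(3,4)] by (simp add: mult.assoc)
    also have "\<dots> \<le> C * norm x + C * norm x"
      using qz(6,7) C(1) by (intro add_mono mult_left_mono)
    finally show "norm (\<phi> x) \<le> 2 * C * norm x" by simp
  qed (use C in simp)
qed

section \<open>Complex Hilbert spaces\<close>

lemma cinner_add_right: "cinner x (y + z) = cinner x y + cinner (x::'h::complex_hilbert) z"
  using cinner_commute[of x "y + z"] cinner_commute[of x y] cinner_commute[of x z]
  by (simp add: cinner_add_left)

lemma cinner_scaleC_right: "cinner x (c *\<^sub>C y) = cnj c * cinner (x::'h::complex_hilbert) y"
  using cinner_commute[of x "c *\<^sub>C y"] cinner_commute[of x y] by (simp add: cinner_scaleC_left)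

lemma cinner_zero_left [simp]: "cinner 0 (x::'h::complex_hilbert) = 0"
  using cinner_scaleC_left[of 0 x x] by simp

lemma cinner_zero_right [simp]: "cinner (x::'h::complex_hilbert) 0 = 0"
  using cinner_scaleC_right[of x 0 x] by simp

lemma cinner_diff_left: "cinner (x - y) z = cinner x z - cinner (y::'h::complex_hilbert) z"
  using cinner_add_left[of "x - y" y z] by simp

lemma cinner_diff_right: "cinner x (y - z) = cinner x y - cinner (x::'h::complex_hilbert) z"
  using cinner_add_right[of x "y - z" z] by simp

lemma cinner_cauchy_schwarz: "cmod (cinner x y) \<le> norm x * norm (y::'h::complex_hilbert)"
proof (cases "y = 0")
  case False
  define N where "N = (norm y)\<^sup>2"
  have N: "N > 0" using False by (simp add: N_def)
  \<comment> \<open>The coefficient of the orthogonal projection of \<open>x\<close> onto the line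
    of \<open>y\<close>.\<close>
  define c where "c = cinner x y / of_real N"
  have "complex_of_real ((norm (x - c *\<^sub>C y))\<^sup>2) = cinner (x - c *\<^sub>C y) (x - c *\<^sub>C y)"
    by (simp only: cinner_self)
  also have "\<dots> = cinner x x - cnj c * cinner x y - (c * cinner y x - c * (cnj c * cinner y y))"
    by (simp add: cinner_diff_left cinner_diff_right cinner_scaleC_left cinner_scaleC_right algebra_simps)
  also have "c * (cnj c * cinner y y) = cnj c * cinner x y"
    using N by (simp add: c_def cinner_self N_def)
  also have "c * cinner y x = of_real ((cmod (cinner x y))\<^sup>2 / N)"
    using cinner_commute[of y x] by (simp add: c_def complex_norm_square[symmetric])
  also have "cnj c * cinner x y = of_real ((cmod (cinner x y))\<^sup>2 / N)"
    by (simp add: c_def complex_norm_square[symmetric] mult.commute)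
  finally have "complex_of_real ((norm (x - c *\<^sub>C y))\<^sup>2)
      = of_real ((norm x)\<^sup>2 - (cmod (cinner x y))\<^sup>2 / N)"
    by (simp add: cinner_self)
  then have "(norm (x - c *\<^sub>C y))\<^sup>2 = (norm x)\<^sup>2 - (cmod (cinner x y))\<^sup>2 / N"
    by (simp only: of_real_eq_iff)
  then have "(cmod (cinner x y))\<^sup>2 / N \<le> (norm x)\<^sup>2"
    by (metis diff_ge_0_iff_ge zero_le_power2)
  then have "(cmod (cinner x y))\<^sup>2 \<le> (norm x * norm y)\<^sup>2"
    using N by (simp add: pos_divide_le_eq N_def power_mult_distrib)
  then show ?thesis by (rule power2_le_imp_le) simp
qed simp

lemma bounded_linear_cinner_left: "bounded_linear (\<lambda>x. cinner x (y::'h::complex_hilbert))"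
proof (rule bounded_linear_intro[where K = "norm y"])
  show "norm (cinner x y) \<le> norm x * norm y" for x by (rule cinner_cauchy_schwarz)
qed (simp_all add: cinner_add_left scaleR_scaleC cinner_scaleC_left scaleR_conv_of_real)

text \<open>Since \<open>\<parallel>T\<^sup>i v - T\<^sup>j v\<parallel>\<^sup>2 = \<parallel>T\<^sup>i v\<parallel>\<^sup>2 + \<parallel>T\<^sup>j v\<parallel>\<^sup>2 - 2\<parallel>T\<^sup>k v\<parallel>\<^sup>2\<close> for \<open>i + j = 2k\<close>, convergence of the
  decreasing sequence \<open>\<parallel>T\<^sup>n v\<parallel>\<close> suffices.\<close>

lemma self_adjoint_contraction_even_powers_convergent:
  fixes T :: "'h::complex_hilbert \<Rightarrow> 'h"
  assumes sym: "\<And>x y. cinner (T x) y = cinner x (T y)" and contr: "\<And>x. norm (T x) \<le> norm x"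
  shows "convergent (\<lambda>n. (T ^^ (2 * n)) v)"
proof -
  define a where "a n = (norm ((T ^^ n) v))\<^sup>2" for n
  have "decseq a"
    unfolding a_def by (rule decseq_SucI) (simp add: contr power_mono)
  moreover have "\<And>n. 0 \<le> a n" by (simp add: a_def)
  ultimately obtain L where L: "a \<longlonglongrightarrow> L" using decseq_convergent[of a 0] by blast
  have shift: "cinner ((T ^^ (i + k)) v) ((T ^^ j) v) = cinner ((T ^^ i) v) ((T ^^ (j + k)) v)" for i j k
    by (induction k arbitrary: j) (simp_all add: sym, metis add_Suc funpow.simps(2) o_apply)
  have cross: "cinner ((T ^^ i) v) ((T ^^ j) v) = of_real (a k)" if "i + j = 2 * k" for i j k
  proof (cases "i \<le> j")
    case True
    then have "j = k + (k - i)" "i + (k - i) = k" using that by auto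
    then have "cinner ((T ^^ k) v) ((T ^^ k) v) = cinner ((T ^^ i) v) ((T ^^ j) v)"
      using shift[of i "k - i" k] by metis
    then show ?thesis by (simp add: cinner_self a_def)
  next
    case False
    then have "i = k + (k - j)" "j + (k - j) = k" using that by auto
    then have "cinner ((T ^^ i) v) ((T ^^ j) v) = cinner ((T ^^ k) v) ((T ^^ k) v)"
      using shift[of k "k - j" j] by metis
    then show ?thesis by (simp add: cinner_self a_def)
  qed
  have dist2: "(dist ((T ^^ (2 * m)) v) ((T ^^ (2 * n)) v))\<^sup>2 = a (2 * m) + a (2 * n) - 2 * a (m + n)" for m n
  proof -
    let ?x = "(T ^^ (2 * m)) v" and ?y = "(T ^^ (2 * n)) v"
    have "complex_of_real ((norm (?x - ?y))\<^sup>2) = cinner (?x - ?y) (?x - ?y)"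
      by (simp only: cinner_self)
    also have "\<dots> = cinner ?x ?x - cinner ?x ?y - (cinner ?y ?x - cinner ?y ?y)"
      by (simp add: cinner_diff_left cinner_diff_right)
    also have "\<dots> = of_real (a (2 * m)) - of_real (a (m + n)) - (of_real (a (m + n)) - of_real (a (2 * n)))"
      using cross[of "2 * m" "2 * m" "2 * m"] cross[of "2 * n" "2 * n" "2 * n"]
        cross[of "2 * m" "2 * n" "m + n"] cross[of "2 * n" "2 * m" "m + n"] by simp
    also have "\<dots> = of_real (a (2 * m) + a (2 * n) - 2 * a (m + n))" by simp
    finally show ?thesis unfolding dist_norm of_real_eq_iff .
  qed
  have "Cauchy (\<lambda>n. (T ^^ (2 * n)) v)"
  proof (rule metric_CauchyI)
    fix e :: real assume e: "e > 0"
    \<comment> \<open>The deviations of \<open>a\<close> from \<open>L\<close> enter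
      \<open>dist2\<close> with weights 1, 1 and 2, whence the denominator 4.\<close>
    then have "e\<^sup>2 / 4 > 0" by simp
    then obtain N where N: "\<And>n. n \<ge> N \<Longrightarrow> norm (a n - L) < e\<^sup>2 / 4"
      using LIMSEQ_D[OF L] by blast
    have "dist ((T ^^ (2 * m)) v) ((T ^^ (2 * n)) v) < e" if "m \<ge> N" "n \<ge> N" for m n
    proof -
      have "\<bar>a (2 * m) - L\<bar> < e\<^sup>2 / 4" "\<bar>a (2 * n) - L\<bar> < e\<^sup>2 / 4" "\<bar>a (m + n) - L\<bar> < e\<^sup>2 / 4"
        using N[of "2 * m"] N[of "2 * n"] N[of "m + n"] that by auto
      then have "(dist ((T ^^ (2 * m)) v) ((T ^^ (2 * n)) v))\<^sup>2 < e\<^sup>2"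
        unfolding dist2 by linarith
      then show ?thesis using e by (auto intro: power2_less_imp_less)
    qed
    then show "\<exists>M. \<forall>m\<ge>M. \<forall>n\<ge>M. dist ((T ^^ (2 * m)) v) ((T ^^ (2 * n)) v) < e" by blast
  qed
  then show ?thesis by (rule Cauchy_convergent)
qed

section \<open>Representations\<close>

lemma star_representationD:
  fixes \<pi> :: "'a::cstar_algebra \<Rightarrow> 'h::complex_hilbert \<Rightarrow>\<^sub>L 'h"
  assumes "star_representation \<pi>"
  shows "\<pi> a (c *\<^sub>C v) = c *\<^sub>C \<pi> a v"
    "\<pi> (a + b) v = \<pi> a v + \<pi> b v"
    "\<pi> (a * b) v = \<pi> a (\<pi> b v)"
    "\<pi> (c *\<^sub>C a) v = c *\<^sub>C \<pi> a v"
    "\<pi> (r *\<^sub>R a) v = r *\<^sub>R \<pi> a v"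
    "cinner (\<pi> (star a) v) w = cinner v (\<pi> a w)"
proof -
  show "\<pi> a (c *\<^sub>C v) = c *\<^sub>C \<pi> a v"
    using assms by (auto simp: star_representation_def bounded_operators_def)
  show "\<pi> (a + b) v = \<pi> a v + \<pi> b v" "\<pi> (a * b) v = \<pi> a (\<pi> b v)"
    "cinner (\<pi> (star a) v) w = cinner v (\<pi> a w)"
    using assms by (simp_all add: star_representation_def blinfun.add_left)
  show smult: "\<pi> (c *\<^sub>C a) v = c *\<^sub>C \<pi> a v" for c
    using assms by (simp add: star_representation_def)
  show "\<pi> (r *\<^sub>R a) v = r *\<^sub>R \<pi> a v"
    unfolding scaleR_scaleC by (rule smult)
qed

lemma star_representation_diff:
  assumes "star_representation \<pi>"
  shows "\<pi> (a - b) v = \<pi> a v - \<pi> b v"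
  using star_representationD(2)[OF assms, of "a - b" b v] by simp

text \<open>The element \<open>d\<close> makes the bounds purely algebraic: expanding the inner
  product gives \<open>*\<close>, in which both squared norms are nonnegative. No continuity of
  \<open>\<pi>\<close> in its algebra argument enters.\<close>

lemma star_representation_square:
  fixes \<pi> :: "'a::cstar_algebra \<Rightarrow> 'h::complex_hilbert \<Rightarrow>\<^sub>L 'h"
  assumes rep: "star_representation \<pi>" and a: "star a = a" "norm a < 1"
  shows "norm (\<pi> a v) \<le> norm v" "norm (v - \<pi> (a * a) v) \<le> norm v"
proof -
  obtain d where d: "star d = d" "d + d - d * d = a * a"
    using sqrt_one_minus_square[OF a] by metis
  note R = star_representationD[OF rep] star_representation_diff[OF rep]
  have sd: "cinner (\<pi> d x) y = cinner x (\<pi> d y)" for x y using R(6)[of d x y] d by simp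
  have sa: "cinner (\<pi> a x) y = cinner x (\<pi> a y)" for x y using R(6)[of a x y] a by simp
  have *: "(norm (x - \<pi> d x))\<^sup>2 = (norm x)\<^sup>2 - (norm (\<pi> a x))\<^sup>2" for x
  proof -
    have "complex_of_real ((norm (x - \<pi> d x))\<^sup>2) = cinner (x - \<pi> d x) (x - \<pi> d x)"
      by (simp only: cinner_self)
    also have "\<dots> = cinner x x - cinner x (\<pi> (d + d - d * d) x)"
      by (simp add: R(2,3,7) cinner_diff_left cinner_diff_right cinner_add_right sd)
    also have "\<dots> = cinner x x - cinner (\<pi> a x) (\<pi> a x)" by (simp only: d R(3) sa)
    also have "\<dots> = of_real ((norm x)\<^sup>2 - (norm (\<pi> a x))\<^sup>2)" by (simp add: cinner_self)
    finally show ?thesis unfolding of_real_eq_iff .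
  qed
  have "0 \<le> (norm v)\<^sup>2 - (norm (\<pi> a v))\<^sup>2" unfolding *[symmetric] by simp
  then have "(norm (\<pi> a v))\<^sup>2 \<le> (norm v)\<^sup>2" by simp
  then show "norm (\<pi> a v) \<le> norm v" by (rule power2_le_imp_le) simp
  have C: "norm (x - \<pi> d x) \<le> norm x" for x
  proof (rule power2_le_imp_le)
    show "(norm (x - \<pi> d x))\<^sup>2 \<le> (norm x)\<^sup>2" using *[of x] by simp
  qed simp
  have eq: "v - \<pi> (a * a) v = (v - \<pi> d v) - \<pi> d (v - \<pi> d v)"
    by (simp add: R(2,3,7) blinfun.diff_right flip: d(2))
  show "norm (v - \<pi> (a * a) v) \<le> norm v"
    unfolding eq using C[of "v - \<pi> d v"] C[of v] by (rule order_trans)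
qed

text \<open>A self-adjoint element is rescaled to norm 1/2, which costs the factor 2. The general
  case follows from \<open>star x * x\<close> by Cauchy-Schwarz.\<close>

lemma star_representation_bounded:
  fixes \<pi> :: "'a::cstar_algebra \<Rightarrow> 'h::complex_hilbert \<Rightarrow>\<^sub>L 'h"
  assumes rep: "star_representation \<pi>"
  shows "norm (\<pi> x v) \<le> 2 * norm x * norm v"
proof -
  note R = star_representationD[OF rep] star_representation_diff[OF rep]
  have sa: "norm (\<pi> a v) \<le> 2 * norm a * norm v" if a: "star a = a" for a v
  proof (cases "a = 0")
    case True
    then show ?thesis using R(5)[of 0 0 v] by simp
  next
    case False
    let ?b = "(1 / (2 * norm a)) *\<^sub>R a"
    have "norm (\<pi> ?b v) \<le> norm v"
      using False a by (intro star_representation_square rep) (auto simp: star_scaleR)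
    then show ?thesis using False by (simp add: R(5) pos_divide_le_eq mult.commute)
  qed
  have "complex_of_real ((norm (\<pi> x v))\<^sup>2) = cinner (\<pi> (star x * x) v) v"
    using cinner_self[of "\<pi> x v"] R(6)[of "star x" "\<pi> x v" v] R(6)[of x v "\<pi> x v"] 
      cinner_commute[of v "\<pi> (star x) (\<pi> x v)"]
    by (simp add: R(3) star_star R(6))
  then have "(norm (\<pi> x v))\<^sup>2 = cmod (cinner (\<pi> (star x * x) v) v)"
    by (metis abs_of_nonneg norm_of_real zero_le_power2)
  also have "\<dots> \<le> norm (\<pi> (star x * x) v) * norm v" by (rule cinner_cauchy_schwarz)
  also have "\<dots> \<le> (2 * norm (star x * x) * norm v) * norm v"
    by (intro mult_right_mono sa) (simp_all add: star_mult star_star)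
  also have "\<dots> = 2 * (norm x * norm v)\<^sup>2" by (simp add: cstar_identity power2_eq_square)
  also have "\<dots> \<le> (2 * (norm x * norm v))\<^sup>2" by (simp add: power2_eq_square)
  finally have "norm (\<pi> x v) \<le> 2 * (norm x * norm v)" by (rule power2_le_imp_le) simp
  then show ?thesis by (simp add: mult.assoc)
qed

lemma star_representation_bounded_linear:
  fixes \<pi> :: "'a::cstar_algebra \<Rightarrow> 'h::complex_hilbert \<Rightarrow>\<^sub>L 'h"
  assumes rep: "star_representation \<pi>"
  shows "bounded_linear (\<lambda>x. \<pi> x v)"
proof (rule bounded_linear_intro[where K = "2 * norm v"])
  show "norm (\<pi> x v) \<le> norm x * (2 * norm v)" for x
    using star_representation_bounded[OF rep, of x v] by (simp add: mult.commute mult.left_commute)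
qed (simp_all add: star_representationD[OF rep])

text \<open>For each point \<open>c\<close> of a countable dense set and each \<open>n\<close>, a
  point of \<open>D\<close> within \<open>1 / Suc n\<close> of \<open>c\<close> is chosen whenever
  one exists.\<close>

lemma separable_dense_sequence_in_subset:
  fixes D :: "'a::metric_space set"
  assumes "separable_space (euclidean :: 'a topology)" and "D \<noteq> {}"
  obtains y :: "nat \<Rightarrow> 'a" where "range y \<subseteq> D" "\<And>x e. x \<in> D \<Longrightarrow> e > 0 \<Longrightarrow> \<exists>j. dist x (y j) < e"
proof -
  obtain C :: "'a set" where C: "countable C" "closure C = UNIV"
    using assms(1) by (auto simp: separable_space_def)
  define I where "I = {(c, n::nat). c \<in> C \<and> (\<exists>z\<in>D. dist c z < 1 / Suc n)}"
  define p where "p i = (SOME z. z \<in> D \<and> dist (fst i) z < 1 / Suc (snd i))" for i :: "'a \<times> nat"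
  have p: "p i \<in> D" "dist (fst i) (p i) < 1 / Suc (snd i)" if "i \<in> I" for i
  proof -
    have "\<exists>z. z \<in> D \<and> dist (fst i) z < 1 / Suc (snd i)" using that by (auto simp: I_def)
    then have "p i \<in> D \<and> dist (fst i) (p i) < 1 / Suc (snd i)" unfolding p_def by (rule someI_ex)
    then show "p i \<in> D" "dist (fst i) (p i) < 1 / Suc (snd i)" by auto
  qed
  have dense: "\<exists>i\<in>I. dist x (p i) < e" if x: "x \<in> D" and e: "e > 0" for x e
  proof -
    obtain n where n: "1 / real (Suc n) < e / 2" using e nat_approx_posE[of "e/2"] by auto
    have "x \<in> closure C" using C by simp
    then obtain c where c: "c \<in> C" "dist c x < 1 / real (Suc n)"
      unfolding closure_approachable by (metis zero_less_divide_1_iff of_nat_0_less_iff zero_less_Suc)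
    then have i: "(c, n) \<in> I" using x by (auto simp: I_def)
    have "dist x (p (c, n)) \<le> dist c x + dist c (p (c, n))"
      using dist_triangle[of x "p (c, n)" c] by (simp add: dist_commute)
    also have "\<dots> < e" using c p(2)[OF i] n by simp
    finally show ?thesis using i by blast
  qed
  have "I \<subseteq> C \<times> UNIV" by (auto simp: I_def)
  then have "countable I" using C(1) by (meson countable_SIGMA countable_subset countableI_type)
  moreover obtain x0 where "x0 \<in> D" using assms(2) by blast
  then have "I \<noteq> {}" using dense[of x0 1] by auto
  ultimately obtain j :: "nat \<Rightarrow> 'a \<times> nat" where j: "range j = I"
    by (metis uncountable_def)
  show ?thesis
  proof (rule that[of "p \<circ> j"])
    show "range (p \<circ> j) \<subseteq> D" using j p(1) by (metis image_subset_iff o_apply rangeI)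
    show "\<exists>k. dist x ((p \<circ> j) k) < e" if "x \<in> D" "e > 0" for x e
      using dense[OF that] j by (metis imageE o_apply)
  qed
qed

text \<open>The elements \<open>f n\<close> are \<open>1 - (1 - s)\<^sup>2\<^sup>n\<close> for a strictly positive \<open>s \<in> J\<close>; they converge strongly
  to the projection onto the closed span of \<open>\<pi> J H\<close>.\<close>

lemma ideal_strong_projection:
  fixes \<pi> :: "'a::cstar_algebra \<Rightarrow> 'h::complex_hilbert \<Rightarrow>\<^sub>L 'h"
  assumes sep: "separable_space (euclidean :: 'a topology)"
    and B: "closed_star_subalgebra B" and J: "closed_two_sided_ideal J B"
    and rep: "star_representation \<pi>"
  obtains f :: "nat \<Rightarrow> 'a" where "\<And>n. f n \<in> J" "\<And>n. norm (f n) \<le> 2"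
    "\<And>v. \<exists>u. (\<forall>x\<in>J. \<pi> x u = 0) \<and> (\<lambda>n. \<pi> (f n) v) \<longlonglongrightarrow> v - u"
proof -
  note R = star_representationD[OF rep] star_representation_diff[OF rep]
  note SJ = closed_subalgebra_ideal[OF J]
  define D where "D = {y\<in>J. star y = y \<and> norm y < 1}"
  have "0 \<in> D" using closed_subalgebraD(3)[OF SJ] by (simp add: D_def)
  then have "D \<noteq> {}" by blast
  from separable_dense_sequence_in_subset[OF sep this] obtain y :: "nat \<Rightarrow> 'a"
    where y: "range y \<subseteq> D" and dense: "\<And>x e. x \<in> D \<Longrightarrow> e > 0 \<Longrightarrow> \<exists>j. dist x (y j) < e" by blast
  have yD: "y j \<in> J" "star (y j) = y j" "norm (y j) < 1" for j using y by (auto simp: D_def)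
  \<comment> \<open>Total weight 1 makes \<open>s\<close> a cocontraction; strict positivity of
    every weight later lets \<open>\<pi> s u = 0\<close> force \<open>\<pi> (y n) u = 0\<close> for
    each \<open>n\<close>.\<close>
  define c :: "nat \<Rightarrow> real" where "c n = (1/2) ^ Suc n" for n
  have c: "0 \<le> c n" "c n > 0" "c sums 1" for n
    using power_half_series by (simp_all add: c_def[abs_def])
  define s where "s = (\<Sum>n. c n *\<^sub>R (y n * y n))"
  note ser = cocontraction_convex_series[OF cocontraction_square[OF yD(2,3)] c(1,3)]
  have s: "cocontraction s" unfolding s_def by (rule ser(2))
  have sJ: "s \<in> J"
    unfolding s_def
    by (rule closed_subalgebra_suminf[OF SJ _ summable_norm_cancel[OF ser(1)]])
      (intro closed_subalgebraD(4,7)[OF SJ] yD)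
  have Ss: "(\<lambda>n. c n *\<^sub>R \<pi> (y n * y n) v) sums \<pi> s v" for v
    using bounded_linear.sums[OF star_representation_bounded_linear[OF rep, of v]
        summable_sums[OF summable_norm_cancel[OF ser(1)]]]
    by (simp add: R(5) s_def)
  \<comment> \<open>\<open>T\<close> is \<open>1 - \<pi> s\<close>, a self-adjoint contraction whose
    powers represent \<open>1 - \<pi> (copower s n)\<close>.\<close>
  define T where "T v = v - \<pi> s v" for v
  have cs: "(\<lambda>n. c n * norm v) sums norm v" for v :: 'h
    using sums_mult2[OF c(3), of "norm v"] by simp
  have Tc: "norm (T v) \<le> norm v" for v
  proof (rule norm_sums_le[OF _ cs])
    have "(\<lambda>n. c n *\<^sub>R v - c n *\<^sub>R \<pi> (y n * y n) v) sums (1 *\<^sub>R v - \<pi> s v)"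
      by (intro sums_diff Ss sums_scaleR_left c)
    then show "(\<lambda>n. c n *\<^sub>R (v - \<pi> (y n * y n) v)) sums T v"
      by (simp add: T_def scaleR_diff_right)
    show "norm (c n *\<^sub>R (v - \<pi> (y n * y n) v)) \<le> c n * norm v" for n
      using star_representation_square(2)[OF rep yD(2,3)] c(1)[of n] by (simp add: mult_left_mono)
  qed
  have Sc: "norm (\<pi> s v) \<le> norm v" for v
  proof (rule norm_sums_le[OF Ss cs])
    show "norm (c n *\<^sub>R \<pi> (y n * y n) v) \<le> c n * norm v" for n
      using star_representation_square(1)[OF rep yD(2,3), of n v]
        star_representation_square(1)[OF rep yD(2,3), of n "\<pi> (y n) v"] c(1)[of n]
      by (simp add: R(3) mult_left_mono)
  qed
  have Tsym: "cinner (T x) z = cinner x (T z)" for x z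
    using R(6)[of s x z] cocontractionD(1)[OF s]
    by (simp add: T_def cinner_diff_left cinner_diff_right)
  have pow: "\<pi> (copower s n) v = v - (T ^^ n) v" for n v
  proof (induction n)
    case 0
    show ?case using R(5)[of 0 0 v] by simp
  next
    case (Suc n)
    have "\<pi> (copower s (Suc n)) v = \<pi> s v + (v - (T ^^ n) v) - \<pi> s (v - (T ^^ n) v)"
      by (simp add: R(2,3,7) Suc)
    also have "\<dots> = v - (T ^^ Suc n) v" by (simp add: T_def blinfun.diff_right)
    finally show ?case .
  qed
  show ?thesis
  proof (rule that[of "\<lambda>n. copower s (2 * n)"])
    show "copower s (2 * n) \<in> J" "norm (copower s (2 * n)) \<le> 2" for n
      by (intro copower_in_subalgebra SJ sJ cocontraction_norm_le cocontraction_copower s)+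
    show "\<exists>u. (\<forall>x\<in>J. \<pi> x u = 0) \<and> (\<lambda>n. \<pi> (copower s (2 * n)) v) \<longlonglongrightarrow> v - u" for v
    proof -
      obtain u where u: "(\<lambda>n. (T ^^ (2 * n)) v) \<longlonglongrightarrow> u"
        using self_adjoint_contraction_even_powers_convergent[of T v] Tsym Tc
        by (auto simp: convergent_def)
      have Tlim: "(\<lambda>n. T (g n)) \<longlonglongrightarrow> T l" if "g \<longlonglongrightarrow> l" for g l
        unfolding T_def by (intro tendsto_intros that blinfun.tendsto) 
      have "(\<lambda>n. T (T ((T ^^ (2 * n)) v))) \<longlonglongrightarrow> T (T u)" by (intro Tlim u)
      moreover have "(\<lambda>n. T (T ((T ^^ (2 * n)) v))) \<longlonglongrightarrow> u"
        using LIMSEQ_Suc[OF u] by simp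
      \<comment> \<open>Even powers only give a vector fixed by the square of \<open>T\<close>. This
        says that \<open>w\<close> satisfies \<open>\<pi> s w = 2 *\<^sub>R w\<close>, which is
        impossible for nonzero \<open>w\<close> since \<open>\<pi> s\<close> is a
        contraction.\<close>
      ultimately have TT: "T (T u) = u" by (rule LIMSEQ_unique)
      define w where "w = \<pi> s u"
      have "\<pi> s w = 2 *\<^sub>R w"
        using TT by (simp add: T_def w_def blinfun.diff_right scaleR_2 algebra_simps)
      then have "2 * norm w \<le> norm w" using Sc[of w] by simp
      then have "w = 0" by simp
      then have "(\<lambda>n. c n *\<^sub>R \<pi> (y n * y n) u) sums 0" using Ss[of u] by (simp add: w_def)
      \<comment> \<open>Pairing with \<open>u\<close> turns the vanishing series into one with
        nonnegative terms, each of which must be 0.\<close>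
      from bounded_linear.sums[OF bounded_linear_compose[OF bounded_linear_Re bounded_linear_cinner_left[of u]] this]
      have "(\<lambda>n. Re (cinner (c n *\<^sub>R \<pi> (y n * y n) u) u)) sums 0" by simp
      moreover have "Re (cinner (c n *\<^sub>R \<pi> (y n * y n) u) u) = c n * (norm (\<pi> (y n) u))\<^sup>2" for n
      proof -
        have "cinner (\<pi> (y n * y n) u) u = cinner (\<pi> (y n) u) (\<pi> (y n) u)"
          using R(6)[of "y n" "\<pi> (y n) u" u] by (simp add: yD R(3))
        then show ?thesis by (simp add: scaleR_scaleC cinner_scaleC_left cinner_self)
      qed
      ultimately have sum0: "(\<lambda>n. c n * (norm (\<pi> (y n) u))\<^sup>2) sums 0" by simp
      have yu: "\<pi> (y n) u = 0" for n
      proof -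
        have "c n * (norm (\<pi> (y n) u))\<^sup>2 = 0"
          using suminf_eq_zero_iff[OF sums_summable[OF sum0]] sums_unique[OF sum0] c(1) by simp
        then show ?thesis using c(2)[of n] by simp
      qed
      have Du: "\<pi> x u = 0" if x: "x \<in> D" for x
      proof -
        have "norm (\<pi> x u) \<le> e" if e: "e > 0" for e
        proof -
          define t where "t = e / (2 * norm u + 1)"
          have pos: "2 * norm u + 1 > 0" using norm_ge_zero[of u] by linarith
          then have "t > 0" using e by (simp add: t_def)
          then obtain j where j: "dist x (y j) < t" using dense[OF x] by blast
          have "norm (\<pi> x u) = norm (\<pi> (x - y j) u)" by (simp add: R(7) yu)
          also have "\<dots> \<le> 2 * norm (x - y j) * norm u" by (rule star_representation_bounded[OF rep])
          also have "\<dots> = norm (x - y j) * (2 * norm u)" by simp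
          also have "\<dots> \<le> t * (2 * norm u + 1)"
            using j \<open>t > 0\<close> by (intro mult_mono) (auto simp: dist_norm)
          also have "\<dots> = e" using pos by (simp add: t_def)
          finally show ?thesis .
        qed
        then have "norm (\<pi> x u) \<le> 0" by (rule field_le_epsilon[of _ 0, simplified])
        then show ?thesis by simp
      qed
      have sau: "\<pi> x u = 0" if x: "x \<in> J" "star x = x" for x
      proof -
        define t where "t = norm x + 1"
        have t: "t > 0" "norm x < t" unfolding t_def using norm_ge_zero[of x] by linarith+
        have "(1 / t) *\<^sub>R x \<in> D"
          using t x closed_subalgebraD(7)[OF SJ] by (simp add: D_def star_scaleR)
        from Du[OF this] show ?thesis using t by (simp add: R(5))
      qed
      have "\<pi> x u = 0" if x: "x \<in> J" for x
      proof -
        obtain h k where hk: "h \<in> J" "k \<in> J" "star h = h" "star k = k" "x = h + \<i> *\<^sub>C k"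
          using ideal_cartesian_decomposition[OF B J x] by metis
        have "\<i> *\<^sub>C (0::'h) = 0" using scaleC_scaleC[of \<i> 0 "0::'h"] by simp
        then show ?thesis using sau hk by (simp add: R(2,4))
      qed
      moreover have "(\<lambda>n. \<pi> (copower s (2 * n)) v) \<longlonglongrightarrow> v - u"
        unfolding pow by (intro tendsto_intros u)
      ultimately show ?thesis by blast
    qed
  qed
qed

section \<open>The multiplier\<close>

text \<open>The error vector \<open>u\<close> is annihilated by the self-adjoint set
  \<open>J\<close>, hence orthogonal to all \<open>\<pi> x v\<close> with \<open>x \<in> J\<close>.
  But \<open>\<pi> q w - u\<close> is a limit of such vectors, so \<open>u\<close> is orthogonal to
  itself.\<close>

lemma star_representation_ideal_range:
  fixes \<pi> :: "'a::cstar_algebra \<Rightarrow> 'h::complex_hilbert \<Rightarrow>\<^sub>L 'h"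
  assumes rep: "star_representation \<pi>" and J: "\<And>x. x \<in> J \<Longrightarrow> star x \<in> J"
    and f: "\<And>n. f n \<in> J" and lim: "\<And>v. \<exists>u. (\<forall>x\<in>J. \<pi> x u = 0) \<and> (\<lambda>n. \<pi> (f n) v) \<longlonglongrightarrow> v - u"
    and q: "q \<in> J"
  shows "(\<lambda>n. \<pi> (f n) (\<pi> q w)) \<longlonglongrightarrow> \<pi> q w"
proof -
  note R = star_representationD[OF rep]
  obtain u where u: "\<And>x. x \<in> J \<Longrightarrow> \<pi> x u = 0" and l: "(\<lambda>n. \<pi> (f n) (\<pi> q w)) \<longlonglongrightarrow> \<pi> q w - u"
    using lim by blast
  have orth: "cinner (\<pi> x v) u = 0" if "x \<in> J" for x v
    using R(6)[of "star x" v u] u[OF J[OF that]] by (simp add: star_star)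
  have "(\<lambda>n. cinner (\<pi> (f n) (\<pi> q w)) u) \<longlonglongrightarrow> cinner (\<pi> q w - u) u"
    by (rule bounded_linear.tendsto[OF bounded_linear_cinner_left l])
  then have "cinner (\<pi> q w - u) u = 0"
    by (simp add: orth f LIMSEQ_const_iff)
  then have "u = 0" by (simp add: cinner_diff_left orth q cinner_self)
  with l show ?thesis by simp
qed

theorem theorem9p5:
  fixes B J :: "'a::cstar_algebra set"
    and \<phi> :: "'a \<Rightarrow> 'a"
    and \<pi> :: "'a \<Rightarrow> 'h::complex_hilbert \<Rightarrow>\<^sub>L 'h"
  assumes "separable_space (euclidean :: 'a topology)"
    and "closed_star_subalgebra B"
    and "contains_approximate_unit B"
    and "virtual_commutant B J \<phi>"
    and "faithful_representation \<pi>"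
  shows "\<exists>\<tau>\<in>bounded_operators. \<forall>x\<in>J.
           \<tau> o\<^sub>L \<pi> x \<in> range \<pi> \<and>
           \<pi> (\<phi> x) = \<tau> o\<^sub>L \<pi> x \<and>
           (\<forall>b\<in>B. \<tau> o\<^sub>L \<pi> b = \<pi> b o\<^sub>L \<tau>)"
proof -
  have rep: "star_representation \<pi>" using assms(5) by (simp add: faithful_representation_def)
  note R = star_representationD[OF rep] star_representation_diff[OF rep]
  note vcD = virtual_commutantD[OF assms(4)]
  note J = vcD(1)
  note SJ = closed_subalgebra_ideal[OF J]
  have JB: "x \<in> B" if "x \<in> J" for x using J that by (auto simp: closed_two_sided_ideal_def)
  have ideal: "b * x \<in> J" "x * b \<in> J" if "x \<in> J" "b \<in> B" for x b
    using J that by (auto simp: closed_two_sided_ideal_def)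
  obtain M where M: "0 \<le> M" "\<And>x. x \<in> J \<Longrightarrow> norm (\<phi> x) \<le> M * norm x"
    using virtual_commutant_bounded[OF assms(2,4)] by blast
  obtain f where f: "\<And>n. f n \<in> J" "\<And>n. norm (f n) \<le> 2"
    and proj: "\<And>v. \<exists>u. (\<forall>x\<in>J. \<pi> x u = 0) \<and> (\<lambda>n. \<pi> (f n) v) \<longlonglongrightarrow> v - u"
    using ideal_strong_projection[OF assms(1,2) J rep] by metis
  note range_lim = star_representation_ideal_range[OF rep ideal_star_closed[OF assms(2) J] f(1) proj]
  \<comment> \<open>Here \<open>\<phi>\<close> is moved onto the left factors, so that the right
    factors from \<open>J\<close> act on \<open>u\<close> first.\<close>
  have \<phi>_kernel: "\<pi> (\<phi> x) u = 0" if x: "x \<in> J" and u: "\<And>y. y \<in> J \<Longrightarrow> \<pi> y u = 0" for x u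
  proof -
    obtain q z q' z' where qz: "q \<in> J" "z \<in> J" "q' \<in> J" "z' \<in> J" "x = q * z + q' * z'"
      using ideal_factorization[OF assms(2) J x] by metis
    have "\<phi> x = \<phi> q * z + \<phi> q' * z'"
      using qz JB by (simp add: vcD(2,6) closed_subalgebraD(4)[OF SJ])
    then show ?thesis using qz u by (simp add: R(2,3))
  qed
  \<comment> \<open>Now \<open>\<phi>\<close> goes onto the right factors, and the left factors
    place the vector in the span of the ranges where \<open>\<pi> (f n)\<close> tends to the
    identity.\<close>
  have \<phi>_range: "(\<lambda>n. \<pi> (f n) (\<pi> (\<phi> x) w)) \<longlonglongrightarrow> \<pi> (\<phi> x) w" if x: "x \<in> J" for x w
  proof -
    obtain q z q' z' where qz: "q \<in> J" "z \<in> J" "q' \<in> J" "z' \<in> J" "x = q * z + q' * z'"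
      using ideal_factorization[OF assms(2) J x] by metis
    have eq: "\<phi> x = q * \<phi> z + q' * \<phi> z'"
      using qz JB by (simp add: vcD(2,5) closed_subalgebraD(4)[OF SJ])
    show ?thesis
      unfolding eq R(2,3) blinfun.add_right by (intro tendsto_add range_lim qz)
  qed
  \<comment> \<open>The 4 combines the bound 2 on \<open>norm (f n)\<close> with the constant 2 of
    \<open>star_representation_bounded\<close>; adding 1 permits division by
    \<open>K\<close>.\<close>
  define K where "K = 4 * M + 1"
  have K: "K > 0" using M(1) by (simp add: K_def)
  define g where "g n v = \<pi> (\<phi> (f n)) v" for n v
  have g_bound: "norm (g n v) \<le> K * norm v" for n v
  proof -
    have "norm (g n v) \<le> 2 * norm (\<phi> (f n)) * norm v"
      unfolding g_def by (rule star_representation_bounded[OF rep])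
    also have "norm (\<phi> (f n)) \<le> M * 2"
      using M(2)[OF f(1)] mult_left_mono[OF f(2) M(1)] by (rule order_trans)
    also have "2 * (M * 2) * norm v \<le> K * norm v" by (intro mult_right_mono) (auto simp: K_def)
    finally show ?thesis by (simp add: mult_right_mono)
  qed
  have g_lim: "(\<lambda>n. g n (\<pi> x w)) \<longlonglongrightarrow> \<pi> (\<phi> x) w" if x: "x \<in> J" for x w
  proof -
    have "\<phi> (f n) * x = f n * \<phi> x" for n
      using vcD(5)[OF x JB[OF f(1)], of n] vcD(6)[OF f(1) JB[OF x], of n] by simp
    then have "g n (\<pi> x w) = \<pi> (f n) (\<pi> (\<phi> x) w)" for n
      unfolding g_def by (metis R(3))
    then show ?thesis using \<phi>_range[OF x] by simp
  qed
  \<comment> \<open>Every \<open>g n\<close> kills \<open>u\<close>, so \<open>v\<close> may be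
    replaced by \<open>\<pi> (f m) v\<close> at an error uniform in \<open>n\<close>; on that vector
    \<open>g_lim\<close> gives convergence.\<close>
  have g_conv: "convergent (\<lambda>n. g n v)" for v
  proof (rule Cauchy_convergent, rule metric_CauchyI)
    fix e :: real assume e: "e > 0"
    obtain u where u: "\<forall>x\<in>J. \<pi> x u = 0" "(\<lambda>n. \<pi> (f n) v) \<longlonglongrightarrow> v - u" using proj by blast
    have "e / (3 * K) > 0" using e K by simp
    then obtain m where m: "norm (\<pi> (f m) v - (v - u)) < e / (3 * K)"
      using LIMSEQ_D[OF u(2)] by blast
    let ?h = "\<lambda>n. g n (\<pi> (f m) v)"
    have close: "dist (g n v) (?h n) < e / 3" for n
    proof -
      have "g n u = 0" unfolding g_def using \<phi>_kernel[OF f(1)] u(1) by blast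
      then have "g n v - ?h n = - g n (\<pi> (f m) v - (v - u))"
        by (simp add: g_def blinfun.diff_right)
      then have "dist (g n v) (?h n) \<le> K * norm (\<pi> (f m) v - (v - u))"
        using g_bound by (simp add: dist_norm)
      also have "\<dots> < K * (e / (3 * K))" using m K by (intro mult_strict_left_mono)
      also have "\<dots> = e / 3" using K by simp
      finally show ?thesis .
    qed
    have "Cauchy ?h" by (rule LIMSEQ_imp_Cauchy[OF g_lim[OF f(1)]])
    then obtain N where N: "\<And>a b. a \<ge> N \<Longrightarrow> b \<ge> N \<Longrightarrow> dist (?h a) (?h b) < e / 3"
      using e metric_CauchyD[of ?h "e / 3"] by auto
    have "dist (g a v) (g b v) < e" if "a \<ge> N" "b \<ge> N" for a b
      using dist_triangle[of "g a v" "g b v" "?h a"] dist_triangle[of "?h a" "g b v" "?h b"]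
        close[of a] close[of b] N[OF that] by (simp add: dist_commute)
    then show "\<exists>N. \<forall>a\<ge>N. \<forall>b\<ge>N. dist (g a v) (g b v) < e" by blast
  qed
  define t where "t v = lim (\<lambda>n. g n v)" for v
  have t: "(\<lambda>n. g n v) \<longlonglongrightarrow> t v" for v
    unfolding t_def using g_conv by (simp add: convergent_LIMSEQ_iff)
  have t_add: "t (v + w) = t v + t w" for v w
    by (rule LIMSEQ_unique[OF t]) (simp add: g_def blinfun.add_right tendsto_add t[unfolded g_def])
  have t_scaleC: "t (c *\<^sub>C v) = c *\<^sub>C t v" for c v
    by (rule LIMSEQ_unique[OF t])
      (simp add: g_def R(1) bounded_linear.tendsto[OF bounded_linear_scaleC t[unfolded g_def]])
  have bl: "bounded_linear t"
  proof (rule bounded_linear_intro[where K = K])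
    show "norm (t v) \<le> norm v * K" for v
      using tendsto_upperbound[OF tendsto_norm[OF t]] g_bound
      by (simp add: mult.commute)
  qed (simp_all add: t_add scaleR_scaleC t_scaleC)
  have t_\<pi>: "t (\<pi> x w) = \<pi> (\<phi> x) w" if "x \<in> J" for x w
    by (rule LIMSEQ_unique[OF t g_lim[OF that]])
  have t_kernel: "t u = 0" if "\<And>x. x \<in> J \<Longrightarrow> \<pi> x u = 0" for u
  proof -
    have "g n u = 0" for n unfolding g_def by (rule \<phi>_kernel[OF f(1) that])
    then show ?thesis using t[of u] by (simp add: LIMSEQ_const_iff)
  qed
  \<comment> \<open>As \<open>x * b \<in> J\<close> for \<open>x \<in> J\<close>, the operator
    \<open>\<pi> b\<close> preserves the common kernel of \<open>\<pi> x\<close> for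
    \<open>x \<in> J\<close>, on which \<open>t\<close> is 0. On the vectors
    \<open>\<pi> (f n) v\<close> the claim is \<open>\<phi> (b * f n) = b * \<phi> (f n)\<close>,
    and continuity covers the rest.\<close>
  have t_commute: "t (\<pi> b v) = \<pi> b (t v)" if b: "b \<in> B" for b v
  proof -
    obtain u where u: "\<forall>x\<in>J. \<pi> x u = 0" and l: "(\<lambda>n. \<pi> (f n) v) \<longlonglongrightarrow> v - u" using proj by blast
    have "\<pi> x (\<pi> b u) = 0" if "x \<in> J" for x
      using u ideal(2)[OF that b] R(3)[of x b u] by simp
    then have tu: "t (\<pi> b u) = 0" "t u = 0" using u by (auto intro: t_kernel)
    have "(\<lambda>n. t (\<pi> b (\<pi> (f n) v))) \<longlonglongrightarrow> t (\<pi> b (v - u))"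
      by (intro bounded_linear.tendsto[OF bl] blinfun.tendsto tendsto_const l)
    moreover have "(\<lambda>n. \<pi> b (t (\<pi> (f n) v))) \<longlonglongrightarrow> \<pi> b (t (v - u))"
      by (intro bounded_linear.tendsto[OF bl] blinfun.tendsto tendsto_const l)
    moreover have "t (\<pi> b (\<pi> (f n) v)) = \<pi> b (t (\<pi> (f n) v))" for n
    proof -
      have "t (\<pi> b (\<pi> (f n) v)) = \<pi> (\<phi> (b * f n)) v"
        using t_\<pi>[OF ideal(1)[OF f(1) b]] by (simp add: R(3))
      then show ?thesis using t_\<pi>[OF f(1)] by (simp add: vcD(5)[OF f(1) b] R(3))
    qed
    ultimately have "t (\<pi> b (v - u)) = \<pi> b (t (v - u))" using LIMSEQ_unique by simp
    then show ?thesis by (simp add: blinfun.diff_right linear_simps[OF bl] tu)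
  qed
  define \<tau> where "\<tau> = Blinfun t"
  have \<tau>: "blinfun_apply \<tau> = t" unfolding \<tau>_def by (rule bounded_linear_Blinfun_apply[OF bl])
  have "\<tau> \<in> bounded_operators" by (simp add: bounded_operators_def \<tau> t_scaleC)
  moreover have "\<pi> (\<phi> x) = \<tau> o\<^sub>L \<pi> x" if "x \<in> J" for x
    by (rule blinfun_eqI) (simp add: \<tau> t_\<pi>[OF that])
  moreover have "\<tau> o\<^sub>L \<pi> b = \<pi> b o\<^sub>L \<tau>" if "b \<in> B" for b
    by (rule blinfun_eqI) (simp add: \<tau> t_commute[OF that])
  ultimately show ?thesis by (metis rangeI)
qed

end
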